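(* Let $\mathfrak{g}$ be a real $4$-dimensional Lie algebra. Then $\mathfrak{g}$ admits a left-invariant non-Einstein solution $(g,F)$ to the Einstein--Maxwell equations if and only if $\mathfrak{g}$ is isomorphic to one of the following Lie algebras, each given by a basis $e_1,e_2,e_3,e_4$ and its brackets (brackets of basis vectors that are neither listed nor determined from listed ones by skew-symmetry are zero): 1) $2\mathcal{A}_2$: $[e_1,e_2]=e_2,\ [e_3,e_4]=e_4$; 2) $\mathcal{A}_2\oplus 2\mathcal{A}_1$: $[e_1,e_2]=e_2$; 3) $\mathcal{A}_{4,6}^{a,0}$ for some real number $a\neq 0$: $[e_1,e_4]=ae_1,\ [e_2,e_4]=-e_3,\ [e_3,e_4]=e_2$; 4) $\mathcal{A}_{4,9}^{-\frac12}$: $[e_2,e_3]=e_1,\ [e_1,e_4]=\frac12 e_1,\ [e_2,e_4]=e_2,\ [e_3,e_4]=-\frac12 e_3$.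
   Context: Let $\mathfrak{g}$ be a real $4$-dimensional Lie algebra and $G$ a Lie group with Lie algebra $\mathfrak{g}$. Left-invariant Riemannian metrics on $G$ are identified with inner products $g$ on $\mathfrak{g}$, and left-invariant $2$-forms on $G$ with elements $F\in\Lambda^2\mathfrak{g}^*$. The exterior derivative on left-invariant forms is determined by $(d\alpha)(x,y)=-\alpha([x,y])$ for $\alpha\in\mathfrak{g}^*$, so that for a $2$-form $(dF)(x,y,z)=-F([x,y],z)+F([x,z],y)-F([y,z],x)$. Fix an orientation of $\mathfrak{g}$; $\star$ denotes the Hodge star operator of $g$ with respect to this orientation. Let $Ric$ be the Ricci tensor of the Levi-Civita connection of the left-invariant metric $g$ (viewed as a symmetric bilinear form on $\mathfrak{g}$), $s$ the scalar curvature, and $Ric_0=Ric-\frac{s}{4}g$ the trace-free Ricci tensor. The metric $g$ is Einstein if $Ric_0=0$. Let $F\circ F$ denote the symmetric bilinear form with components $(F\circ F)_{ij}=F_{is}{F^{s}}_{j}$, where indices are raised with $g$ and repeated indices are summed (i.e. $(F\circ F)_{ij}=\sum_{s,t}F_{is}g^{st}F_{tj}$), and let $[F\circ F]_0=F\circ F-\frac14\,\mathrm{tr}_g(F\circ F)\,g$ be its trace-free part. A left-invariant solution to the Einstein--Maxwell equations on $\mathfrak{g}$ is a pair $(g,F)$ consisting of an inner product $g$ on $\mathfrak{g}$ and $F\in\Lambda^2\mathfrak{g}^*$ such that $$Ric_0=-[F\circ F]_0,\qquad dF=0,\qquad d\star F=0.$$ (Reversing the orientation only changes the sign of $\star$,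 so the choice of orientation does not affect these equations.) The solution is non-Einstein if $Ric_0\neq 0$. *)

theory Defs
  imports "HOL-Analysis.Analysis"
begin

section \<open>Lie algebras\<close>

definition lie_bracket :: "('a::real_vector \<Rightarrow> 'a \<Rightarrow> 'a) \<Rightarrow> bool" where
  "lie_bracket br \<longleftrightarrow> bilinear br \<and> (\<forall>x. br x x = 0) \<and>
     (\<forall>x y z. br x (br y z) + br y (br z x) + br z (br x y) = 0)"

definition lie_isomorphic ::
  "('a::real_vector \<Rightarrow> 'a \<Rightarrow> 'a) \<Rightarrow> ('b::real_vector \<Rightarrow> 'b \<Rightarrow> 'b) \<Rightarrow> bool" where
  "lie_isomorphic br br' \<longleftrightarrow>
     (\<exists>f. linear f \<and> bij f \<and> (\<forall>x y. f (br x y) = br' (f x) (f y)))"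

abbreviation std :: "4 \<Rightarrow> real^4" where "std i \<equiv> axis i 1"

text \<open>The skew-symmetric bilinear operation on \<open>real^4\<close> with \<open>[std i, std j] = v\<close> for each
  entry \<open>(i, j, v)\<close> of the list, all brackets of basis vectors not determined by these being zero.
  (In the index type \<open>4\<close> the numeral \<open>4\<close> equals \<open>0\<close>; the numerals \<open>1, 2, 3, 4\<close> are its
  four distinct elements.)\<close>

definition bracket_from :: "(4 \<times> 4 \<times> (real^4)) list \<Rightarrow> real^4 \<Rightarrow> real^4 \<Rightarrow> real^4" where
  "bracket_from T x y = (\<Sum>(i, j, v)\<leftarrow>T. (x $ i * y $ j - x $ j * y $ i) *\<^sub>R v)"

definition two_A2 :: "real^4 \<Rightarrow> real^4 \<Rightarrow> real^4" where
  "two_A2 = bracket_from [(1, 2, std 2), (3, 4, std 4)]"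

definition A2_plus_2A1 :: "real^4 \<Rightarrow> real^4 \<Rightarrow> real^4" where
  "A2_plus_2A1 = bracket_from [(1, 2, std 2)]"

definition A4_6_0 :: "real \<Rightarrow> real^4 \<Rightarrow> real^4 \<Rightarrow> real^4" where
  "A4_6_0 a = bracket_from [(1, 4, a *\<^sub>R std 1), (2, 4, - std 3), (3, 4, std 2)]"

definition A4_9_minus_half :: "real^4 \<Rightarrow> real^4 \<Rightarrow> real^4" where
  "A4_9_minus_half = bracket_from
     [(2, 3, std 1), (1, 4, (1/2) *\<^sub>R std 1), (2, 4, std 2), (3, 4, (- 1/2) *\<^sub>R std 3)]"

section \<open>Linear algebra in dimension four\<close>

text \<open>Traces and index contractions below are written in components with respect to an ordered
  basis \<open>b\<close>. Their values do not depend on \<open>b\<close>. The only use of \<open>b\<close> beyond that is as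
  the choice of an orientation (the one making \<open>b\<close> positive) in the volume form.\<close>

definition is_basis :: "(4 \<Rightarrow> 'a::real_vector) \<Rightarrow> bool" where
  "is_basis b \<longleftrightarrow> inj b \<and> independent (range b) \<and> span (range b) = UNIV"

definition coord :: "(4 \<Rightarrow> 'a::real_vector) \<Rightarrow> 'a \<Rightarrow> real^4" where
  "coord b x = (\<chi> i. representation (range b) x (b i))"

definition inner_product :: "('a::real_vector \<Rightarrow> 'a \<Rightarrow> real) \<Rightarrow> bool" where
  "inner_product g \<longleftrightarrow> bilinear g \<and> (\<forall>x y. g x y = g y x) \<and> (\<forall>x. x \<noteq> 0 \<longrightarrow> g x x > 0)"

definition two_form :: "('a::real_vector \<Rightarrow> 'a \<Rightarrow> real) \<Rightarrow> bool" where
  "two_form F \<longleftrightarrow> bilinear F \<and> (\<forall>x. F x x = 0)"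

definition endo_trace :: "(4 \<Rightarrow> 'a::real_vector) \<Rightarrow> ('a \<Rightarrow> 'a) \<Rightarrow> real" where
  "endo_trace b T = (\<Sum>i\<in>UNIV. coord b (T (b i)) $ i)"

definition gram :: "(4 \<Rightarrow> 'a::real_vector) \<Rightarrow> ('a \<Rightarrow> 'a \<Rightarrow> real) \<Rightarrow> real^4^4" where
  "gram b g = (\<chi> i j. g (b i) (b j))"

definition ginv :: "(4 \<Rightarrow> 'a::real_vector) \<Rightarrow> ('a \<Rightarrow> 'a \<Rightarrow> real) \<Rightarrow> 4 \<Rightarrow> 4 \<Rightarrow> real" where
  "ginv b g i j = matrix_inv (gram b g) $ i $ j"

definition metric_trace ::
  "(4 \<Rightarrow> 'a::real_vector) \<Rightarrow> ('a \<Rightarrow> 'a \<Rightarrow> real) \<Rightarrow> ('a \<Rightarrow> 'a \<Rightarrow> real) \<Rightarrow> real" where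
  "metric_trace b g h = (\<Sum>i\<in>UNIV. \<Sum>j\<in>UNIV. ginv b g i j * h (b i) (b j))"

definition trace_free ::
  "(4 \<Rightarrow> 'a::real_vector) \<Rightarrow> ('a \<Rightarrow> 'a \<Rightarrow> real) \<Rightarrow> ('a \<Rightarrow> 'a \<Rightarrow> real) \<Rightarrow> 'a \<Rightarrow> 'a \<Rightarrow> real" where
  "trace_free b g h x y = h x y - metric_trace b g h / 4 * g x y"

section \<open>Curvature of left-invariant metrics\<close>

definition is_levi_civita ::
  "('a::real_vector \<Rightarrow> 'a \<Rightarrow> 'a) \<Rightarrow> ('a \<Rightarrow> 'a \<Rightarrow> real) \<Rightarrow> ('a \<Rightarrow> 'a \<Rightarrow> 'a) \<Rightarrow> bool" where
  "is_levi_civita br g D \<longleftrightarrow> bilinear D \<and>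
     (\<forall>x y. D x y - D y x = br x y) \<and>
     (\<forall>x y z. g (D x y) z + g y (D x z) = 0)"

text \<open>For left-invariant fields the function \<open>g(y, z)\<close> is constant, so the left-hand side of the
  last condition equals \<open>x(g(y, z)) = 0\<close>. The connection exists and is unique whenever \<open>g\<close> is
  an inner product on a finite-dimensional Lie algebra.\<close>

definition levi_civita ::
  "('a::real_vector \<Rightarrow> 'a \<Rightarrow> 'a) \<Rightarrow> ('a \<Rightarrow> 'a \<Rightarrow> real) \<Rightarrow> 'a \<Rightarrow> 'a \<Rightarrow> 'a" where
  "levi_civita br g = (THE D. is_levi_civita br g D)"

definition curvature ::
  "('a::real_vector \<Rightarrow> 'a \<Rightarrow> 'a) \<Rightarrow> ('a \<Rightarrow> 'a \<Rightarrow> real) \<Rightarrow> 'a \<Rightarrow> 'a \<Rightarrow> 'a \<Rightarrow> 'a" where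
  "curvature br g x y z = (let D = levi_civita br g in
     D x (D y z) - D y (D x z) - D (br x y) z)"

definition ricci :: "(4 \<Rightarrow> 'a::real_vector) \<Rightarrow> ('a \<Rightarrow> 'a \<Rightarrow> 'a) \<Rightarrow> ('a \<Rightarrow> 'a \<Rightarrow> real) \<Rightarrow>
    'a \<Rightarrow> 'a \<Rightarrow> real" where
  "ricci b br g y z = endo_trace b (\<lambda>x. curvature br g x y z)"

text \<open>\<open>trace_free b g (ricci b br g)\<close> is \<open>Ric - s/4 g\<close>, the scalar curvature being
  \<open>s = metric_trace b g (ricci b br g)\<close>.\<close>

definition ricci0 :: "(4 \<Rightarrow> 'a::real_vector) \<Rightarrow> ('a \<Rightarrow> 'a \<Rightarrow> 'a) \<Rightarrow> ('a \<Rightarrow> 'a \<Rightarrow> real) \<Rightarrow>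
    'a \<Rightarrow> 'a \<Rightarrow> real" where
  "ricci0 b br g = trace_free b g (ricci b br g)"

definition einstein ::
  "(4 \<Rightarrow> 'a::real_vector) \<Rightarrow> ('a \<Rightarrow> 'a \<Rightarrow> 'a) \<Rightarrow> ('a \<Rightarrow> 'a \<Rightarrow> real) \<Rightarrow> bool" where
  "einstein b br g \<longleftrightarrow> (\<forall>x y. ricci0 b br g x y = 0)"

section \<open>Left-invariant two-forms\<close>

definition ext_deriv ::
  "('a::real_vector \<Rightarrow> 'a \<Rightarrow> 'a) \<Rightarrow> ('a \<Rightarrow> 'a \<Rightarrow> real) \<Rightarrow> 'a \<Rightarrow> 'a \<Rightarrow> 'a \<Rightarrow> real" where
  "ext_deriv br F x y z = - F (br x y) z + F (br x z) y - F (br y z) x"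

definition closed_form :: "('a::real_vector \<Rightarrow> 'a \<Rightarrow> 'a) \<Rightarrow> ('a \<Rightarrow> 'a \<Rightarrow> real) \<Rightarrow> bool" where
  "closed_form br F \<longleftrightarrow> (\<forall>x y z. ext_deriv br F x y z = 0)"

definition volume_form ::
  "(4 \<Rightarrow> 'a::real_vector) \<Rightarrow> ('a \<Rightarrow> 'a \<Rightarrow> real) \<Rightarrow> 'a \<Rightarrow> 'a \<Rightarrow> 'a \<Rightarrow> 'a \<Rightarrow> real" where
  "volume_form b g x y z w =
     sqrt (det (gram b g)) * det (vector [coord b x, coord b y, coord b z, coord b w] :: real^4^4)"

text \<open>In index notation \<open>(\<star>F)\<^sub>k\<^sub>l = 1/2 F\<^sup>i\<^sup>j vol\<^sub>i\<^sub>j\<^sub>k\<^sub>l\<close>, with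
  \<open>F\<^sup>i\<^sup>j = F\<^sub>s\<^sub>t g\<^sup>s\<^sup>i g\<^sup>t\<^sup>j\<close>.\<close>

definition hodge_star :: "(4 \<Rightarrow> 'a::real_vector) \<Rightarrow> ('a \<Rightarrow> 'a \<Rightarrow> real) \<Rightarrow>
    ('a \<Rightarrow> 'a \<Rightarrow> real) \<Rightarrow> 'a \<Rightarrow> 'a \<Rightarrow> real" where
  "hodge_star b g F x y = (1/2) * (\<Sum>i\<in>UNIV. \<Sum>j\<in>UNIV. \<Sum>s\<in>UNIV. \<Sum>t\<in>UNIV.
     F (b s) (b t) * ginv b g s i * ginv b g t j * volume_form b g (b i) (b j) x y)"

definition form_comp :: "(4 \<Rightarrow> 'a::real_vector) \<Rightarrow> ('a \<Rightarrow> 'a \<Rightarrow> real) \<Rightarrow>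
    ('a \<Rightarrow> 'a \<Rightarrow> real) \<Rightarrow> 'a \<Rightarrow> 'a \<Rightarrow> real" where
  "form_comp b g F x y = (\<Sum>s\<in>UNIV. \<Sum>t\<in>UNIV. F x (b s) * ginv b g s t * F (b t) y)"

definition einstein_maxwell :: "(4 \<Rightarrow> 'a::real_vector) \<Rightarrow> ('a \<Rightarrow> 'a \<Rightarrow> 'a) \<Rightarrow>
    ('a \<Rightarrow> 'a \<Rightarrow> real) \<Rightarrow> ('a \<Rightarrow> 'a \<Rightarrow> real) \<Rightarrow> bool" where
  "einstein_maxwell b br g F \<longleftrightarrow> inner_product g \<and> two_form F \<and>
     (\<forall>x y. ricci0 b br g x y = - trace_free b g (form_comp b g F) x y) \<and>
     closed_form br F \<and> closed_form br (hodge_star b g F)"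

end

theory Submission
  imports Defs
begin

text \<open>In an orthonormal frame \<open>e\<^sub>1, e\<^sub>2, e\<^sub>3, e\<^sub>4\<close> with \<open>F = p e\<^sup>1\<^sup>2 + q e\<^sup>3\<^sup>4\<close> the Hodge star only
exchanges \<open>p\<close> and \<open>q\<close>, up to a common sign, and \<open>-[F \<circ> F]\<^sub>0\<close> equals \<open>(p\<^sup>2 - q\<^sup>2) / 2\<close> times the
difference of the metrics of the two planes \<open>P = \<langle>e\<^sub>1, e\<^sub>2\<rangle>\<close> and \<open>Q = \<langle>e\<^sub>3, e\<^sub>4\<rangle>\<close>. For a solution
that is not Einstein this gives \<open>p\<^sup>2 \<noteq> q\<^sup>2\<close>, so \<open>dF = d\<star>F = 0\<close> decouples into \<open>de\<^sup>1\<^sup>2 = de\<^sup>3\<^sup>4 = 0\<close>, and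
the Ricci tensor is \<open>l g\<^sub>P + m g\<^sub>Q\<close> with \<open>l - m = p\<^sup>2 - q\<^sup>2 \<noteq> 0\<close>. Conversely such a frame carries a
solution. The form \<open>F\<close> has thereby been eliminated: the question is which Lie algebras have an
\<open>adapted_frame\<close> with \<open>l \<noteq> m\<close> (lemmas \<open>einstein_maxwell_if_adapted\<close> and
\<open>adapted_frame_if_einstein_maxwell\<close>).

The form \<open>e\<^sup>1\<^sup>2\<close> is closed exactly if \<open>Q\<close> is a subalgebra that acts without trace on the
quotient by \<open>Q\<close>, and likewise for \<open>e\<^sup>3\<^sup>4\<close>. Hence \<open>P\<close> and \<open>Q\<close> are two-dimensional subalgebras and
\<open>[z, x] = A\<^sub>z x - B\<^sub>x z\<close> for \<open>z \<in> Q\<close>, \<open>x \<in> P\<close>, with \<open>A\<close> and \<open>B\<close> representations of \<open>Q\<close> on \<open>P\<close> and of \<open>P\<close> on \<open>Q\<close>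
by trace-free matrices; the rest of the Jacobi identity is one compatibility condition on
each side. Rotations of \<open>P\<close> and \<open>Q\<close> achieve \<open>[e\<^sub>1, e\<^sub>2] = a e\<^sub>2\<close> and \<open>[e\<^sub>3, e\<^sub>4] = c e\<^sub>4\<close> (locale
\<open>split_frame\<close>), and the equations that remain are solved by hand.

Up to exchanging \<open>P\<close> and \<open>Q\<close> there are three cases. If \<open>a\<close> and \<open>c\<close> are both nonzero, the Jacobi
identity leaves \<open>2\<A>\<^sub>2\<close>, \<open>\<A>\<^sub>4\<^sub>,\<^sub>9\<close> with parameter \<open>-1/2\<close> and one extension of \<open>\<real>\<close> by an abelian ideal \<open>\<real>\<^sup>3\<close>.
If only \<open>a\<close> is nonzero, it leaves \<open>\<A>\<^sub>4\<^sub>,\<^sub>9\<close> (when \<open>B\<close> does not vanish on \<open>e\<^sub>2\<close>) and again extensions of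
\<open>\<real>\<close> by \<open>\<real>\<^sup>3\<close>. If \<open>a = c = 0\<close>, only such extensions occur. So curvature has to be looked at only for
extensions of \<open>\<real>\<close> by \<open>\<real>\<^sup>3\<close>. In the first case the vanishing of \<open>Ric(e\<^sub>1, e\<^sub>3)\<close> forces \<open>l = m\<close>. In the
others \<open>Ric(e\<^sub>1, e\<^sub>1) - Ric(e\<^sub>2, e\<^sub>2)\<close>, or its analogue on \<open>Q\<close>, is minus a sum of squares; its
vanishing leaves an action by rotations, that is \<open>\<A>\<^sub>2 \<oplus> 2\<A>\<^sub>1\<close> or \<open>\<A>\<^sub>4\<^sub>,\<^sub>6\<close> when \<open>a \<noteq> 0\<close>, and \<open>l = m\<close> when
\<open>a = 0\<close>.\<close>

section \<open>Bases of a four-dimensional space\<close>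

lemma card_range_basis:
  fixes b :: "4 \<Rightarrow> 'a::real_vector"
  assumes "is_basis b" shows "card (range b) = 4" "finite (range b)"
  using assms by (auto simp: is_basis_def card_image)

lemma is_basis_if_spans:
  fixes b f :: "4 \<Rightarrow> 'a::real_vector"
  assumes b: "is_basis b" and f: "range b \<subseteq> span (range f)"
  shows "is_basis f"
proof -
  obtain B where B: "B \<subseteq> range f" "independent B" "range f \<subseteq> span B"
    using maximal_independent_subset[of "range f"] by metis
  have fin: "finite B" by (rule finite_subset[OF B(1)]) simp
  have "range b \<subseteq> span B"
    using f B(3) span_mono[OF B(3)] by (metis order_trans span_span)
  then have "card (range b) \<le> card B"
    using independent_span_bound[OF fin] b by (auto simp: is_basis_def)
  moreover have "card B \<le> card (range f)" by (rule card_mono) (use B in auto)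
  moreover have "card (range f) \<le> 4" using card_image_le[of "UNIV::4 set" f] by simp
  ultimately have c: "card B = 4" "card (range f) = 4" using card_range_basis[OF b] by auto
  have "B = range f" by (rule card_subset_eq) (use B c in auto)
  moreover have "inj f" using c by (intro eq_card_imp_inj_on) auto
  moreover have "span (range f) = UNIV"
    using b span_mono[OF f] by (simp add: is_basis_def span_span top.extremum_unique)
  ultimately show ?thesis using B by (simp add: is_basis_def)
qed

lemma is_basis_if_independent:
  fixes b f :: "4 \<Rightarrow> 'a::real_vector"
  assumes b: "is_basis b" and "inj f" "independent (range f)"
  shows "is_basis f"
proof -
  have "x \<in> span (range f)" for x
  proof (rule ccontr)
    assume x: "x \<notin> span (range f)"
    then have ind: "independent (insert x (range f))"
      using assms(3) independent_insertI[OF x] by simp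
    have "x \<notin> range f" using x by (auto intro: span_base)
    then have "card (insert x (range f)) = 5" using card_image[OF assms(2)] by simp
    moreover have "insert x (range f) \<subseteq> span (range b)" using b by (auto simp: is_basis_def)
    ultimately show False
      using independent_span_bound[OF card_range_basis(2)[OF b] ind] card_range_basis[OF b] by simp
  qed
  then show ?thesis using assms by (auto simp: is_basis_def)
qed

lemma coord_expand:
  assumes "is_basis b" shows "x = (\<Sum>i\<in>UNIV. coord b x $ i *\<^sub>R b i)"
proof -
  have "(\<Sum>v\<in>range b. representation (range b) x v *\<^sub>R v) = x"
    using assms by (intro real_vector.sum_representation_eq) (auto simp: is_basis_def)
  then show ?thesis using assms by (simp add: sum.reindex is_basis_def coord_def)
qed

lemma linear_coord:
  assumes "is_basis b" shows "linear (coord b)"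
  by (rule linearI) (use assms in \<open>auto simp: coord_def is_basis_def vec_eq_iff
      real_vector.representation_add real_vector.representation_scale\<close>)

lemma coord_basis:
  assumes "is_basis b" shows "coord b (b i) = axis i 1"
  using assms by (auto simp: coord_def is_basis_def vec_eq_iff axis_def
      real_vector.representation_basis inj_eq)

lemma coord_eqI:
  assumes b: "is_basis b" and x: "x = (\<Sum>i\<in>UNIV. c i *\<^sub>R b i)" shows "coord b x $ i = c i"
proof -
  have "coord b x = (\<Sum>i\<in>UNIV. c i *\<^sub>R axis i 1)"
    unfolding x by (simp add: linear_sum[OF linear_coord[OF b]] linear_cmul[OF linear_coord[OF b]] coord_basis[OF b])
  then show ?thesis by (simp add: axis_def if_distrib cong: if_cong)
qed

lemma bij_coord:
  assumes b: "is_basis b" shows "bij (coord b)"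
proof (rule bijI)
  show "inj (coord b)" by (rule injI) (metis coord_expand[OF b])
  show "surj (coord b)"
  proof (rule surjI)
    fix v :: "real^4"
    show "coord b (\<Sum>i\<in>UNIV. v $ i *\<^sub>R b i) = v"
      by (simp add: vec_eq_iff coord_eqI[OF b])
  qed
qed

lemma bilinear_sum_sum:
  assumes h: "bilinear h"
  shows "h (\<Sum>i\<in>A. c i *\<^sub>R u i) (\<Sum>j\<in>B. d j *\<^sub>R v j) = (\<Sum>i\<in>A. \<Sum>j\<in>B. (c i * d j) *\<^sub>R h (u i) (v j))"
proof -
  have l: "linear (\<lambda>x. h x y)" "linear (h z)" for y z using h by (auto simp: bilinear_def)
  show ?thesis
    by (simp only: linear_sum[OF l(1)] linear_cmul[OF l(1)] linear_sum[OF l(2)] linear_cmul[OF l(2)]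
        scaleR_sum_right scaleR_scaleR mult.commute) (rule sum.swap)
qed

section \<open>Orthonormal frames and contractions\<close>

definition orthonormal_frame :: "('a::real_vector \<Rightarrow> 'a \<Rightarrow> real) \<Rightarrow> (4 \<Rightarrow> 'a) \<Rightarrow> bool" where
  "orthonormal_frame g e \<longleftrightarrow> (\<forall>i j. g (e i) (e j) = (if i = j then 1 else 0))"

definition frame_of :: "'a \<Rightarrow> 'a \<Rightarrow> 'a \<Rightarrow> 'a \<Rightarrow> 4 \<Rightarrow> 'a" where
  "frame_of u v w z i = (if i = 1 then u else if i = 2 then v else if i = 3 then w else z)"

lemma frame_of_simps [simp]:
  "frame_of u v w z 1 = u" "frame_of u v w z 2 = v" "frame_of u v w z 3 = w" "frame_of u v w z 4 = z"
  by (simp_all add: frame_of_def)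

lemma det_4:
  "det (A::real^4^4) =
     A$1$1 * A$2$2 * A$3$3 * A$4$4 - A$1$1 * A$2$2 * A$3$4 * A$4$3
   - A$1$1 * A$2$3 * A$3$2 * A$4$4 + A$1$1 * A$2$3 * A$3$4 * A$4$2
   + A$1$1 * A$2$4 * A$3$2 * A$4$3 - A$1$1 * A$2$4 * A$3$3 * A$4$2
   - A$1$2 * A$2$1 * A$3$3 * A$4$4 + A$1$2 * A$2$1 * A$3$4 * A$4$3
   + A$1$2 * A$2$3 * A$3$1 * A$4$4 - A$1$2 * A$2$3 * A$3$4 * A$4$1
   - A$1$2 * A$2$4 * A$3$1 * A$4$3 + A$1$2 * A$2$4 * A$3$3 * A$4$1
   + A$1$3 * A$2$1 * A$3$2 * A$4$4 - A$1$3 * A$2$1 * A$3$4 * A$4$2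
   - A$1$3 * A$2$2 * A$3$1 * A$4$4 + A$1$3 * A$2$2 * A$3$4 * A$4$1
   + A$1$3 * A$2$4 * A$3$1 * A$4$2 - A$1$3 * A$2$4 * A$3$2 * A$4$1
   - A$1$4 * A$2$1 * A$3$2 * A$4$3 + A$1$4 * A$2$1 * A$3$3 * A$4$2
   + A$1$4 * A$2$2 * A$3$1 * A$4$3 - A$1$4 * A$2$2 * A$3$3 * A$4$1
   - A$1$4 * A$2$3 * A$3$1 * A$4$2 + A$1$4 * A$2$3 * A$3$2 * A$4$1"
proof -
  have f1: "finite {4::4}" "1 \<notin> {2,3,4::4}" and f2: "finite {3::4,4}" "2 \<notin> {3::4,4}"
    and f3: "finite {2::4,3,4}" "3 \<notin> {4::4}" by auto
  show ?thesis
    unfolding det_def UNIV_4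
    unfolding sum_over_permutations_insert[OF f3(1) f1(2)]
    unfolding sum_over_permutations_insert[OF f2(1) f2(2)]
    unfolding sum_over_permutations_insert[OF f1(1) f3(2)]
    unfolding permutes_sing
    by (simp add: sign_swap_id sign_compose permutation_swap_id permutation_compose sign_id
        Transposition.transpose_def)
qed

lemma vector_4 [simp]:
  "(vector [x,y,z,w] :: ('a::zero)^4) $ 1 = x" "(vector [x,y,z,w] :: ('a::zero)^4) $ 2 = y"
  "(vector [x,y,z,w] :: ('a::zero)^4) $ 3 = z" "(vector [x,y,z,w] :: ('a::zero)^4) $ 4 = w"
  unfolding vector_def by simp_all

text \<open>Laplace expansion along the first two rows. In this form the bilinearity in those rows
is visible without multiplying out.\<close>

lemma det_vector_4:
  "det (vector [u, v, x, y] :: real^4^4) =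
     (u$1 * v$2 - u$2 * v$1) * (x$3 * y$4 - x$4 * y$3)
   - (u$1 * v$3 - u$3 * v$1) * (x$2 * y$4 - x$4 * y$2)
   + (u$1 * v$4 - u$4 * v$1) * (x$2 * y$3 - x$3 * y$2)
   + (u$2 * v$3 - u$3 * v$2) * (x$1 * y$4 - x$4 * y$1)
   - (u$2 * v$4 - u$4 * v$2) * (x$1 * y$3 - x$3 * y$1)
   + (u$3 * v$4 - u$4 * v$3) * (x$1 * y$2 - x$2 * y$1)"
  unfolding det_4 by (simp add: algebra_simps)

lemma bilinear_on_basis:
  fixes f :: "4 \<Rightarrow> 'a::real_vector"
  assumes "bilinear h" "bilinear h'" "is_basis f" "\<And>i j. h (f i) (f j) = h' (f i) (f j)"
  shows "h x y = h' x y"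
  by (subst (1 2) coord_expand[OF assms(3), of x], subst (1 2) coord_expand[OF assms(3), of y])
    (simp add: bilinear_sum_sum assms)

text \<open>One Gram-Schmidt step: a set of fewer than four vectors does not span, so some vector
minus its projection can be normalised.\<close>

lemma orthonormal_extend:
  fixes b :: "4 \<Rightarrow> 'a::real_vector" and g :: "'a \<Rightarrow> 'a \<Rightarrow> real"
  assumes b: "is_basis b" and g: "inner_product g"
    and S: "finite S" "card S < 4" and on: "\<And>u v. u \<in> S \<Longrightarrow> v \<in> S \<Longrightarrow> g u v = (if u = v then 1 else 0)"
  obtains w where "g w w = 1" "\<And>u. u \<in> S \<Longrightarrow> g w u = 0"
proof -
  have bl: "bilinear g" using g by (simp add: inner_product_def)
  have "\<not> range b \<subseteq> span S"
    using independent_span_bound[OF S(1), of "range b"] card_range_basis[OF b] b S(2)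
    by (auto simp: is_basis_def)
  then obtain v where v: "v \<notin> span S" by blast
  define w where "w = v - (\<Sum>u\<in>S. g v u *\<^sub>R u)"
  have sp: "(\<Sum>u\<in>S. g v u *\<^sub>R u) \<in> span S" by (intro span_sum span_scale span_base)
  have "w \<noteq> 0" using v sp by (auto simp: w_def)
  then have pos: "g w w > 0" using g by (simp add: inner_product_def)
  have "g w u = 0" if u: "u \<in> S" for u
  proof -
    have "g (\<Sum>u\<in>S. g v u *\<^sub>R u) u = (\<Sum>x\<in>S. g v x * g x u)"
      using bl by (simp add: bilinear_def linear_sum[of "\<lambda>x. g x u"] linear_cmul[of "\<lambda>x. g x u"])
    also have "\<dots> = (\<Sum>x\<in>S. if x = u then g v u else 0)"
      by (rule sum.cong) (use on u in auto)
    finally show ?thesis using S u by (simp add: w_def bilinear_lsub[OF bl])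
  qed
  then show thesis
    using pos by (intro that[of "(1 / sqrt (g w w)) *\<^sub>R w"])
      (auto simp: bilinear_lmul[OF bl] bilinear_rmul[OF bl] field_simps)
qed

lemma orthonormal_complete:
  fixes b :: "4 \<Rightarrow> 'a::real_vector" and g :: "'a \<Rightarrow> 'a \<Rightarrow> real"
  assumes b: "is_basis b" and g: "inner_product g"
    and uv: "g u u = 1" "g v v = 1" "g u v = 0"
  obtains e where "orthonormal_frame g e" "e 1 = u" "e 2 = v"
proof -
  have sym: "g x y = g y x" for x y using g by (simp add: inner_product_def)
  have "u \<noteq> v" using uv by auto
  have "card {u, v} < 4" using \<open>u \<noteq> v\<close> by simp
  then obtain w where w: "g w w = 1" "\<And>x. x \<in> {u,v} \<Longrightarrow> g w x = 0"
    using orthonormal_extend[OF b g, of "{u,v}"] uv sym by (metis (full_types) empty_iff finite.simps insert_iff)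
  have w': "g w u = 0" "g w v = 0" "w \<noteq> u" "w \<noteq> v" using w uv by auto
  have "card {u, v, w} < 4" using \<open>u \<noteq> v\<close> w' by simp
  then obtain z where z: "g z z = 1" "\<And>x. x \<in> {u,v,w} \<Longrightarrow> g z x = 0"
    using orthonormal_extend[OF b g, of "{u,v,w}"] uv w w' sym \<open>u \<noteq> v\<close>
    by (smt (verit, ccfv_SIG) empty_iff finite.simps insert_iff)
  have "orthonormal_frame g (frame_of u v w z)"
    unfolding orthonormal_frame_def forall_4 using uv w(1) w' z sym by simp
  then show thesis by (rule that) simp_all
qed

lemma orthonormal_frame_exists:
  fixes b :: "4 \<Rightarrow> 'a::real_vector" and g :: "'a \<Rightarrow> 'a \<Rightarrow> real"
  assumes b: "is_basis b" and g: "inner_product g"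
  obtains e where "orthonormal_frame g e"
proof -
  have sym: "g x y = g y x" for x y using g by (simp add: inner_product_def)
  obtain u where u: "g u u = 1"
    using orthonormal_extend[OF b g, of "{}"] by auto
  obtain v where v: "g v v = 1" "g v u = 0"
    using orthonormal_extend[OF b g, of "{u}"] u by auto
  then have "g u v = 0" using sym by metis
  from orthonormal_complete[OF b g u v(1) this] that show thesis by metis
qed

locale framed_space =
  fixes b :: "4 \<Rightarrow> 'a::real_vector" and g :: "'a \<Rightarrow> 'a \<Rightarrow> real" and e :: "4 \<Rightarrow> 'a"
  assumes basis: "is_basis b" and inner: "inner_product g" and frame: "orthonormal_frame g e"
begin

lemma bilinear_g: "bilinear g" using inner by (simp add: inner_product_def)
lemma sym_g: "g x y = g y x" using inner by (simp add: inner_product_def)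

lemmas g_simps = bilinear_ladd[OF bilinear_g] bilinear_radd[OF bilinear_g]
  bilinear_lmul[OF bilinear_g] bilinear_rmul[OF bilinear_g]
  bilinear_lsub[OF bilinear_g] bilinear_rsub[OF bilinear_g]
  bilinear_lneg[OF bilinear_g] bilinear_rneg[OF bilinear_g]
  bilinear_lzero[OF bilinear_g] bilinear_rzero[OF bilinear_g]

lemma linear_g: "linear (\<lambda>x. g x y)" "linear (g x)"
  using bilinear_g by (auto simp: bilinear_def)

lemma g_frame: "g (e i) (e j) = (if i = j then 1 else 0)"
  using frame by (simp add: orthonormal_frame_def)

lemma basis_frame: "is_basis e"
proof (rule is_basis_if_independent[OF basis])
  show "inj e" by (rule injI) (metis g_frame zero_neq_one)
  show "independent (range e)"
  proof
    assume "dependent (range e)"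
    then obtain i where i: "e i \<in> span (range e - {e i})" by (auto simp: dependent_def)
    have "g (e i) y = 0" if "y \<in> span (range e - {e i})" for y
      using that by (induction rule: span_induct_alt) (auto simp: g_simps g_frame split: if_splits)
    then have "g (e i) (e i) = 0" using i .
    then show False by (simp add: g_frame)
  qed
qed

lemma frame_expand: "x = (\<Sum>i\<in>UNIV. g x (e i) *\<^sub>R e i)"
proof -
  have "g x (e j) = coord e x $ j" for j
    by (subst coord_expand[OF basis_frame, of x])
      (simp add: linear_sum[OF linear_g(1)] g_simps g_frame if_distrib cong: if_cong)
  then show ?thesis using coord_expand[OF basis_frame] by simp
qed

lemma frame_eqI: "(\<And>i. g x (e i) = g y (e i)) \<Longrightarrow> x = y"
  by (metis (no_types, lifting) frame_expand sum.cong)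

lemma g_expand: "g x y = (\<Sum>i\<in>UNIV. g x (e i) * g y (e i))"
  by (subst frame_expand[of y]) (simp add: linear_sum[OF linear_g(2)] g_simps mult.commute)

lemma endo_trace_frame:
  assumes T: "linear T"
  shows "endo_trace b T = (\<Sum>i\<in>UNIV. g (T (e i)) (e i))"
proof -
  have "coord b (T (b s)) $ s = (\<Sum>i\<in>UNIV. g (b s) (e i) * coord b (T (e i)) $ s)" for s
    by (subst frame_expand[of "b s"])
      (simp add: linear_sum[OF T] linear_cmul[OF T] linear_sum[OF linear_coord[OF basis]]
        linear_cmul[OF linear_coord[OF basis]])
  then have "endo_trace b T = (\<Sum>i\<in>UNIV. \<Sum>s\<in>UNIV. g (b s) (e i) * coord b (T (e i)) $ s)"
    unfolding endo_trace_def by (simp only:) (rule sum.swap)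
  moreover have "(\<Sum>s\<in>UNIV. g (b s) (e i) * coord b (T (e i)) $ s) = g (T (e i)) (e i)" for i
    by (subst (2) coord_expand[OF basis, of "T (e i)"])
      (simp add: linear_sum[OF linear_g(1)] g_simps mult.commute)
  ultimately show ?thesis by simp
qed

text \<open>The rows are the coordinates of the frame vectors, so that the Gram matrix is congruent
to the identity through this matrix \<open>E\<close> and the inverse of the Gram matrix is \<open>E\<^sup>T E\<close>.\<close>

definition transition :: "real^4^4" where "transition = (\<chi> i s. coord b (e i) $ s)"

lemma transition_gram: "transition ** gram b g ** transpose transition = mat 1"
proof -
  have "g (e i) (e j) = (\<Sum>s\<in>UNIV. \<Sum>t\<in>UNIV. coord b (e i) $ s * coord b (e j) $ t * g (b s) (b t))" for i j
    using bilinear_sum_sum[OF bilinear_g, of "\<lambda>s. coord b (e i) $ s" b UNIV "\<lambda>s. coord b (e j) $ s" b UNIV]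
      coord_expand[OF basis, of "e i"] coord_expand[OF basis, of "e j"] by simp
  then have "(transition ** gram b g ** transpose transition) $ i $ j = g (e i) (e j)" for i j
    by (simp add: matrix_matrix_mult_def transpose_def transition_def gram_def sum_4 algebra_simps)
  then show ?thesis by (simp add: vec_eq_iff mat_def g_frame)
qed

lemma ginv_frame: "ginv b g s t = (\<Sum>k\<in>UNIV. coord b (e k) $ s * coord b (e k) $ t)"
proof -
  have "gram b g ** (transpose transition ** transition) = mat 1"
    using transition_gram matrix_left_right_inverse[of transition "gram b g ** transpose transition"]
    by (simp add: matrix_mul_assoc)
  moreover have "transpose transition ** transition ** gram b g = mat 1"
    using calculation matrix_left_right_inverse by blast
  ultimately have "matrix_inv (gram b g) = transpose transition ** transition"
    unfolding matrix_inv_def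
    by (intro some_equality) (auto, metis matrix_mul_assoc matrix_mul_lid matrix_mul_rid)
  then show ?thesis by (simp add: ginv_def matrix_matrix_mult_def transpose_def transition_def)
qed

text \<open>Every contraction with the inverse metric is a sum over the frame. Metric traces, and
the raised indices in \<open>F \<circ> F\<close> and in the Hodge star, are evaluated through this lemma, which
makes them independent of the basis \<open>b\<close>.\<close>

lemma contraction_frame:
  assumes "bilinear h"
  shows "(\<Sum>s\<in>UNIV. \<Sum>t\<in>UNIV. ginv b g s t * h (b s) (b t)) = (\<Sum>k\<in>UNIV. h (e k) (e k))"
proof -
  have "h (e k) (e k) = (\<Sum>s\<in>UNIV. \<Sum>t\<in>UNIV. coord b (e k) $ s * coord b (e k) $ t * h (b s) (b t))" for k
    by (subst (1 2) coord_expand[OF basis, of "e k"]) (simp add: bilinear_sum_sum[OF assms])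
  then show ?thesis
    by (simp add: ginv_frame sum_4 algebra_simps)
qed

lemma metric_trace_frame:
  "bilinear h \<Longrightarrow> metric_trace b g h = (\<Sum>k\<in>UNIV. h (e k) (e k))"
  unfolding metric_trace_def by (rule contraction_frame)

end

section \<open>Hodge star, connection and Ricci tensor in an orthonormal frame\<close>

text \<open>For orthonormal \<open>u, v\<close> these are the area form and the metric of the plane spanned by
\<open>u, v\<close>, pulled back along the orthogonal projection.\<close>

definition area_form :: "('a::real_vector \<Rightarrow> 'a \<Rightarrow> real) \<Rightarrow> 'a \<Rightarrow> 'a \<Rightarrow> 'a \<Rightarrow> 'a \<Rightarrow> real" where
  "area_form g u v x y = g x u * g y v - g x v * g y u"

definition plane_metric :: "('a::real_vector \<Rightarrow> 'a \<Rightarrow> real) \<Rightarrow> 'a \<Rightarrow> 'a \<Rightarrow> 'a \<Rightarrow> 'a \<Rightarrow> real" where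
  "plane_metric g u v x y = g x u * g y u + g x v * g y v"

lemma bilinearI:
  assumes "\<And>x y z. h (x + y) z = h x z + h y z" "\<And>c x z. h (c *\<^sub>R x) z = c *\<^sub>R h x z"
    "\<And>x y z. h x (y + z) = h x y + h x z" "\<And>c x z. h x (c *\<^sub>R z) = c *\<^sub>R h x z"
  shows "bilinear h"
  using assms by (simp add: bilinear_def linear_iff)

lemma bilinear_lincomb:
  fixes h h' :: "'a::real_vector \<Rightarrow> 'a \<Rightarrow> real"
  assumes "bilinear h" "bilinear h'"
  shows "bilinear (\<lambda>x y. p * h x y + q * h' x y)"
  by (rule bilinearI) (simp_all add: bilinear_ladd[OF assms(1)] bilinear_radd[OF assms(1)]
      bilinear_lmul[OF assms(1)] bilinear_rmul[OF assms(1)] bilinear_ladd[OF assms(2)]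
      bilinear_radd[OF assms(2)] bilinear_lmul[OF assms(2)] bilinear_rmul[OF assms(2)] algebra_simps)

context framed_space begin

lemma form_comp_frame:
  assumes F: "bilinear F"
  shows "form_comp b g F x y = (\<Sum>k\<in>UNIV. F x (e k) * F (e k) y)"
proof -
  have "bilinear (\<lambda>u v. F x u * F v y)"
    by (rule bilinearI) (simp_all add: bilinear_ladd[OF F] bilinear_radd[OF F] bilinear_lmul[OF F]
        bilinear_rmul[OF F] algebra_simps)
  from contraction_frame[OF this] show ?thesis
    by (simp add: form_comp_def mult_ac)
qed

definition frame_coords :: "'a \<Rightarrow> real^4" where "frame_coords x = (\<chi> i. g x (e i))"

text \<open>The volume form is the determinant in the frame, up to the sign \<open>\<sigma>\<close> that records whether
the frame has the orientation of \<open>b\<close>. With the transition matrix \<open>E\<close>, both factors in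
\<open>\<surd>(det gram) \<cdot> det E\<close> depend on \<open>b\<close>; since \<open>E\<close> turns the Gram matrix into the identity, their
product squares to \<open>1\<close>.\<close>

lemma volume_form_frame:
  obtains \<sigma> :: real where "\<sigma> * \<sigma> = 1"
    "\<And>x y z w. volume_form b g x y z w = \<sigma> * det (vector [frame_coords x, frame_coords y, frame_coords z, frame_coords w] :: real^4^4)"
proof -
  have c: "coord b x $ s = (\<Sum>i\<in>UNIV. g x (e i) * coord b (e i) $ s)" for x s
    by (subst frame_expand[of x]) (simp add: linear_sum[OF linear_coord[OF basis]] linear_cmul[OF linear_coord[OF basis]])
  have rows: "vector [coord b x, coord b y, coord b z, coord b w]
      = (vector [frame_coords x, frame_coords y, frame_coords z, frame_coords w] :: real^4^4) ** transition" for x y z w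
    by (simp add: vec_eq_iff forall_4 matrix_matrix_mult_def transition_def frame_coords_def c[symmetric])
  have d: "det transition * det (gram b g) * det transition = 1"
    using arg_cong[OF transition_gram, of det] by (simp add: det_mul det_transpose)
  have "det (gram b g) > 0"
  proof (rule ccontr)
    assume "\<not> det (gram b g) > 0"
    then have "det (gram b g) * (det transition)\<^sup>2 \<le> 0" by (simp add: mult_le_0_iff)
    then show False using d by (simp add: power2_eq_square algebra_simps)
  qed
  then have "(sqrt (det (gram b g)) * det transition) * (sqrt (det (gram b g)) * det transition) = 1"
    using d by (simp add: algebra_simps)
  moreover have "volume_form b g x y z w = sqrt (det (gram b g)) * det transition *
      det (vector [frame_coords x, frame_coords y, frame_coords z, frame_coords w] :: real^4^4)" for x y z w
    by (simp add: volume_form_def rows det_mul)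
  ultimately show thesis by (rule that)
qed

lemma hodge_star_frame:
  assumes F: "bilinear F"
  shows "hodge_star b g F x y =
    (1/2) * (\<Sum>k\<in>UNIV. \<Sum>l\<in>UNIV. F (e k) (e l) * volume_form b g (e k) (e l) x y)"
proof -
  obtain \<sigma> where "\<sigma> * \<sigma> = 1" and v: "\<And>x y z w. volume_form b g x y z w =
      \<sigma> * det (vector [frame_coords x, frame_coords y, frame_coords z, frame_coords w] :: real^4^4)"
    by (rule volume_form_frame) (rule that; assumption)
  define V where "V u v = volume_form b g u v x y" for u v
  define m where "m i j = frame_coords x $ i * frame_coords y $ j - frame_coords x $ j * frame_coords y $ i" for i j
  have V: "bilinear V"
    unfolding V_def v det_vector_4 m_def[symmetric]
    by (rule bilinearI) (simp_all add: frame_coords_def g_simps algebra_simps)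
  have inner_sum: "(\<Sum>j\<in>UNIV. \<Sum>t\<in>UNIV. F u (b t) * ginv b g t j * V w (b j)) = (\<Sum>l\<in>UNIV. F u (e l) * V w (e l))" for u w
  proof -
    have "bilinear (\<lambda>s t. F u s * V w t)"
      by (rule bilinearI) (simp_all add: bilinear_radd[OF F] bilinear_radd[OF V]
          bilinear_rmul[OF F] bilinear_rmul[OF V] algebra_simps)
    from contraction_frame[OF this] show ?thesis
      by (subst sum.swap) (simp add: mult_ac)
  qed
  have "bilinear (\<lambda>u w. \<Sum>l\<in>UNIV. F u (e l) * V w (e l))"
    by (rule bilinearI) (simp_all add: bilinear_ladd[OF F] bilinear_ladd[OF V]
          bilinear_lmul[OF F] bilinear_lmul[OF V] algebra_simps sum.distrib sum_distrib_left)
  note outer = contraction_frame[OF this]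
  have "(\<Sum>i\<in>UNIV. \<Sum>j\<in>UNIV. \<Sum>s\<in>UNIV. \<Sum>t\<in>UNIV.
     F (b s) (b t) * ginv b g s i * ginv b g t j * V (b i) (b j))
    = (\<Sum>i\<in>UNIV. \<Sum>s\<in>UNIV. ginv b g s i * (\<Sum>j\<in>UNIV. \<Sum>t\<in>UNIV. F (b s) (b t) * ginv b g t j * V (b i) (b j)))"
    by (rule sum.cong[OF refl], subst sum.swap) (simp add: sum_distrib_left mult_ac)
  also have "\<dots> = (\<Sum>s\<in>UNIV. \<Sum>i\<in>UNIV. ginv b g s i * (\<Sum>l\<in>UNIV. F (b s) (e l) * V (b i) (e l)))"
    unfolding inner_sum by (rule sum.swap)
  also have "\<dots> = (\<Sum>k\<in>UNIV. \<Sum>l\<in>UNIV. F (e k) (e l) * V (e k) (e l))" by (rule outer)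
  finally show ?thesis by (simp add: hodge_star_def V_def)
qed

lemma bilinear_area_form: "bilinear (area_form g u v)"
  by (rule bilinearI) (simp_all add: area_form_def g_simps algebra_simps)

lemma bilinear_plane_metric: "bilinear (plane_metric g u v)"
  by (rule bilinearI) (simp_all add: plane_metric_def g_simps algebra_simps)

text \<open>A two-form that is block diagonal in the frame stays so, and its coefficients are
exchanged. The sign is harmless because only closedness of the result matters.\<close>

lemma hodge_star_area_forms:
  obtains \<sigma> :: real where "\<sigma> * \<sigma> = 1"
    "\<And>p q. hodge_star b g (\<lambda>x y. p * area_form g (e 1) (e 2) x y + q * area_form g (e 3) (e 4) x y)
      = (\<lambda>x y. \<sigma> * (q * area_form g (e 1) (e 2) x y + p * area_form g (e 3) (e 4) x y))"
proof -
  obtain \<sigma> where s: "\<sigma> * \<sigma> = 1" and v: "\<And>x y z w. volume_form b g x y z w =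
      \<sigma> * det (vector [frame_coords x, frame_coords y, frame_coords z, frame_coords w] :: real^4^4)"
    by (rule volume_form_frame) (rule that; assumption)
  show thesis
  proof (rule that[OF s], intro ext)
    fix p q x y
    show "hodge_star b g (\<lambda>x y. p * area_form g (e 1) (e 2) x y + q * area_form g (e 3) (e 4) x y) x y
      = \<sigma> * (q * area_form g (e 1) (e 2) x y + p * area_form g (e 3) (e 4) x y)"
      by (subst hodge_star_frame[OF bilinear_lincomb[OF bilinear_area_form bilinear_area_form]])
        (simp add: sum_4 v det_vector_4 frame_coords_def g_frame area_form_def algebra_simps)
  qed
qed

end

locale metric_lie_algebra = framed_space +
  fixes br :: "'a \<Rightarrow> 'a \<Rightarrow> 'a"
  assumes lie: "lie_bracket br"
begin

lemma bilinear_br: "bilinear br" using lie by (simp add: lie_bracket_def)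
lemma br_self [simp]: "br x x = 0" using lie by (simp add: lie_bracket_def)
lemma jacobi: "br x (br y z) + br y (br z x) + br z (br x y) = 0"
  using lie by (simp add: lie_bracket_def)

lemmas br_simps = bilinear_ladd[OF bilinear_br] bilinear_radd[OF bilinear_br]
  bilinear_lmul[OF bilinear_br] bilinear_rmul[OF bilinear_br]
  bilinear_lsub[OF bilinear_br] bilinear_rsub[OF bilinear_br]
  bilinear_lneg[OF bilinear_br] bilinear_rneg[OF bilinear_br]
  bilinear_lzero[OF bilinear_br] bilinear_rzero[OF bilinear_br]

lemma br_swap: "br y x = - br x y"
proof -
  have "br (x + y) (x + y) = br x y + br y x" unfolding br_simps by simp
  then show ?thesis by (simp add: eq_neg_iff_add_eq_0 add.commute)
qed

text \<open>Structure constants and Christoffel symbols of the frame.\<close>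

definition C :: "4 \<Rightarrow> 4 \<Rightarrow> 4 \<Rightarrow> real" where "C i j k = g (br (e i) (e j)) (e k)"

definition \<Gamma> :: "4 \<Rightarrow> 4 \<Rightarrow> 4 \<Rightarrow> real" where "\<Gamma> i j k = (C i j k - C j k i + C k i j) / 2"

lemma br_frame: "br (e i) (e j) = (\<Sum>k\<in>UNIV. C i j k *\<^sub>R e k)"
  unfolding C_def by (rule frame_expand)

text \<open>The Koszul formula for left-invariant fields, on which the derivatives of \<open>g\<close> vanish.\<close>

definition koszul :: "'a \<Rightarrow> 'a \<Rightarrow> 'a" where
  "koszul x y = (\<Sum>k\<in>UNIV. ((g (br x y) (e k) - g (br y (e k)) x + g (br (e k) x) y) / 2) *\<^sub>R e k)"

lemma g_koszul: "g (koszul x y) z = (g (br x y) z - g (br y z) x + g (br z x) y) / 2"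
proof -
  define L where "L z = (g (br x y) z - g (br y z) x + g (br z x) y) / 2" for z
  have L: "linear L" by (rule linearI) (simp_all add: L_def g_simps br_simps algebra_simps diff_divide_distrib add_divide_distrib)
  have "L z = (\<Sum>k\<in>UNIV. g z (e k) * L (e k))"
    by (subst frame_expand[of z]) (simp add: linear_sum[OF L] linear_cmul[OF L])
  moreover have "g (koszul x y) z = (\<Sum>k\<in>UNIV. L (e k) * g (e k) z)"
    by (simp add: koszul_def linear_sum[OF linear_g(1)] g_simps L_def)
  ultimately show ?thesis by (simp add: L_def sym_g[of _ z] mult.commute)
qed

lemma bilinear_koszul: "bilinear koszul"
  by (rule bilinearI; rule frame_eqI)
    (simp_all add: g_koszul g_simps br_simps algebra_simps diff_divide_distrib add_divide_distrib)

lemma levi_civita_eq_koszul: "levi_civita br g = koszul"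
  unfolding levi_civita_def
proof (rule the_equality)
  show "is_levi_civita br g koszul"
    unfolding is_levi_civita_def
  proof (intro conjI allI bilinear_koszul)
    fix x y z
    have "g (koszul x y - koszul y x) w = g (br x y) w" for w
      by (simp add: g_koszul g_simps br_swap[of x y] br_swap[of w x] br_swap[of y w] field_simps)
    then show "koszul x y - koszul y x = br x y" by (rule frame_eqI)
    show "g (koszul x y) z + g y (koszul x z) = 0"
      by (simp add: sym_g[of y] g_koszul g_simps br_swap[of x y] br_swap[of z x] br_swap[of y z] field_simps)
  qed
next
  fix D assume D: "is_levi_civita br g D"
  have tor: "g (D x y) z - g (D y x) z = g (br x y) z" for x y z
    using D by (simp add: is_levi_civita_def flip: bilinear_lsub[OF bilinear_g])
  have cmp: "g (D x y) z + g (D x z) y = 0" for x y z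
    using D unfolding is_levi_civita_def sym_g[of "D x z" y] by blast
  have "g (D x y) z = g (koszul x y) z" for x y z
    \<comment> \<open>The usual cyclic combination of torsion-freeness and metricity.\<close>
    using tor[of x y z] tor[of y z x] tor[of z x y] cmp[of x y z] cmp[of y z x] cmp[of z x y]
    by (simp add: g_koszul field_simps)
  then show "D = koszul" by (intro ext frame_eqI)
qed

lemma curvature_koszul:
  "curvature br g x y z = koszul x (koszul y z) - koszul y (koszul x z) - koszul (br x y) z"
  by (simp add: curvature_def levi_civita_eq_koszul Let_def)

lemmas koszul_simps = bilinear_ladd[OF bilinear_koszul] bilinear_radd[OF bilinear_koszul]
  bilinear_lmul[OF bilinear_koszul] bilinear_rmul[OF bilinear_koszul]

lemma ricci_trace: "ricci b br g y z = (\<Sum>i\<in>UNIV. g (curvature br g (e i) y z) (e i))"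
  unfolding ricci_def
  by (rule endo_trace_frame, rule linearI)
    (simp_all add: curvature_koszul koszul_simps br_simps algebra_simps)

lemma bilinear_ricci: "bilinear (ricci b br g)"
  by (rule bilinearI)
    (simp_all add: ricci_trace curvature_koszul koszul_simps br_simps g_simps sum_4 algebra_simps)

lemma koszul_frame: "koszul (e i) (e j) = (\<Sum>k\<in>UNIV. \<Gamma> i j k *\<^sub>R e k)"
  unfolding koszul_def \<Gamma>_def C_def ..

text \<open>Substituting the Christoffel symbols reduces every statement on curvature to an
identity between polynomials in the structure constants.\<close>

lemma ricci_frame:
  "ricci b br g (e j) (e k) =
     (\<Sum>i\<in>UNIV. \<Sum>l\<in>UNIV. \<Gamma> j k l * \<Gamma> i l i - \<Gamma> i k l * \<Gamma> j l i - C i j l * \<Gamma> l k i)"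
proof -
  have g: "g (koszul (e i) (e j)) (e k) = \<Gamma> i j k" for i j k
    by (simp add: g_koszul \<Gamma>_def C_def)
  have r: "linear (koszul x)" and l: "linear (\<lambda>x. koszul x z)" for x z
    using bilinear_koszul by (auto simp: bilinear_def)
  have 1: "g (koszul (e i) (koszul (e j) (e k))) (e m) = (\<Sum>l\<in>UNIV. \<Gamma> j k l * \<Gamma> i l m)" for i j k m
    by (subst koszul_frame[of j k]) (simp add: linear_sum[OF r] linear_cmul[OF r] linear_sum[OF linear_g(1)] g_simps g)
  have 2: "g (koszul (br (e i) (e j)) (e k)) (e m) = (\<Sum>l\<in>UNIV. C i j l * \<Gamma> l k m)" for i j k m
    by (subst br_frame) (simp add: linear_sum[OF l] linear_cmul[OF l] linear_sum[OF linear_g(1)] g_simps g)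
  show ?thesis
    by (simp add: ricci_trace curvature_koszul g_simps 1 2 sum_subtractf)
qed

lemma C_swap: "C j i k = - C i j k"
  by (simp add: C_def br_swap[of "e i"] g_simps)

lemma jacobi_frame:
  "(\<Sum>m\<in>UNIV. C j k m * C i m l + C k i m * C j m l + C i j m * C k m l) = 0"
proof -
  have lin: "linear (br x)" for x using bilinear_br by (auto simp: bilinear_def)
  have 1: "g (br (e i) (br (e j) (e k))) (e l) = (\<Sum>m\<in>UNIV. C j k m * C i m l)" for i j k
    by (subst br_frame[of j k]) (simp add: linear_sum[OF lin] linear_cmul[OF lin] linear_sum[OF linear_g(1)] g_simps C_def)
  have "g (br (e i) (br (e j) (e k)) + br (e j) (br (e k) (e i)) + br (e k) (br (e i) (e j))) (e l) = 0"
    by (simp add: jacobi g_simps)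
  then show ?thesis by (simp add: g_simps 1 sum.distrib)
qed

end

section \<open>Recognising the model algebras\<close>

lemma bracket_from_Nil: "bracket_from [] x y = 0"
  and bracket_from_Cons: "bracket_from ((i, j, v) # T) x y
    = (x $ i * y $ j - x $ j * y $ i) *\<^sub>R v + bracket_from T x y"
  by (simp_all add: bracket_from_def)

lemma bilinear_bracket_from: "bilinear (bracket_from T)"
proof (induction T)
  case Nil
  then show ?case by (auto simp: bracket_from_Nil intro!: bilinearI)
next
  case (Cons t T)
  obtain i j v where t: "t = (i, j, v)" by (cases t)
  show ?case
    unfolding t
    by (rule bilinearI) (simp_all add: bracket_from_Cons bilinear_ladd[OF Cons] bilinear_radd[OF Cons]
        bilinear_lmul[OF Cons] bilinear_rmul[OF Cons] algebra_simps)
qed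

lemma bracket_from_swap: "bracket_from T y x = - bracket_from T x y"
  by (induction T) (auto simp: bracket_from_Nil bracket_from_Cons algebra_simps)

text \<open>A basis with the bracket table of a model gives the isomorphism as its coordinate map.\<close>

lemma lie_isomorphic_bracket_from:
  assumes br: "bilinear br" and f: "is_basis f"
    and eq: "\<And>i j. br (f i) (f j) = (\<Sum>k\<in>UNIV. bracket_from T (std i) (std j) $ k *\<^sub>R f k)"
  shows "lie_isomorphic br (bracket_from T)"
  unfolding lie_isomorphic_def
proof (intro exI conjI allI)
  note lin = linear_coord[OF f]
  show "linear (coord f)" "bij (coord f)" using lin bij_coord[OF f] by simp_all
  fix x y
  show "coord f (br x y) = bracket_from T (coord f x) (coord f y)"
  proof (rule bilinear_on_basis[OF _ _ f, of "\<lambda>x y. coord f (br x y)"])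
    show "bilinear (\<lambda>x y. coord f (br x y))"
      by (rule bilinearI) (simp_all add: bilinear_ladd[OF br] bilinear_radd[OF br] bilinear_lmul[OF br]
          bilinear_rmul[OF br] linear_add[OF lin] linear_cmul[OF lin])
    show "bilinear (\<lambda>x y. bracket_from T (coord f x) (coord f y))"
      by (rule bilinearI) (simp_all add: bilinear_ladd[OF bilinear_bracket_from]
          bilinear_radd[OF bilinear_bracket_from] bilinear_lmul[OF bilinear_bracket_from]
          bilinear_rmul[OF bilinear_bracket_from] linear_add[OF lin] linear_cmul[OF lin])
    fix i j
    show "coord f (br (f i) (f j)) = bracket_from T (coord f (f i)) (coord f (f j))"
      by (simp add: vec_eq_iff coord_basis[OF f] coord_eqI[OF f eq])
  qed
qed

context metric_lie_algebra begin

lemma frame_eqI4: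
  assumes "g x (e 1) = g y (e 1)" "g x (e 2) = g y (e 2)" "g x (e 3) = g y (e 3)" "g x (e 4) = g y (e 4)"
  shows "x = y"
proof (rule frame_eqI)
  have "\<forall>i. g x (e i) = g y (e i)" unfolding forall_4 using assms by simp
  then show "g x (e i) = g y (e i)" for i by simp
qed

lemma span4I:
  "x = c1 *\<^sub>R u1 + c2 *\<^sub>R u2 + c3 *\<^sub>R u3 + c4 *\<^sub>R u4 \<Longrightarrow> x \<in> span {u1, u2, u3, u4}"
  for x :: 'a
  by (auto intro!: span_add span_scale intro: span_base)

text \<open>Only the six brackets with \<open>i < j\<close> have to be compared, and instead of independence it
suffices that the new vectors span, which is shown by solving for the old frame.\<close>

lemma lie_isomorphicI:
  fixes T defines "B \<equiv> \<lambda>i j. bracket_from T (std i) (std j)"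
  assumes span: "e 1 \<in> span {u1, u2, u3, u4}" "e 2 \<in> span {u1, u2, u3, u4}"
      "e 3 \<in> span {u1, u2, u3, u4}" "e 4 \<in> span {u1, u2, u3, u4}"
    and eq: "br u1 u2 = (B 1 2 $ 1) *\<^sub>R u1 + (B 1 2 $ 2) *\<^sub>R u2 + (B 1 2 $ 3) *\<^sub>R u3 + (B 1 2 $ 4) *\<^sub>R u4"
      "br u1 u3 = (B 1 3 $ 1) *\<^sub>R u1 + (B 1 3 $ 2) *\<^sub>R u2 + (B 1 3 $ 3) *\<^sub>R u3 + (B 1 3 $ 4) *\<^sub>R u4"
      "br u1 u4 = (B 1 4 $ 1) *\<^sub>R u1 + (B 1 4 $ 2) *\<^sub>R u2 + (B 1 4 $ 3) *\<^sub>R u3 + (B 1 4 $ 4) *\<^sub>R u4"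
      "br u2 u3 = (B 2 3 $ 1) *\<^sub>R u1 + (B 2 3 $ 2) *\<^sub>R u2 + (B 2 3 $ 3) *\<^sub>R u3 + (B 2 3 $ 4) *\<^sub>R u4"
      "br u2 u4 = (B 2 4 $ 1) *\<^sub>R u1 + (B 2 4 $ 2) *\<^sub>R u2 + (B 2 4 $ 3) *\<^sub>R u3 + (B 2 4 $ 4) *\<^sub>R u4"
      "br u3 u4 = (B 3 4 $ 1) *\<^sub>R u1 + (B 3 4 $ 2) *\<^sub>R u2 + (B 3 4 $ 3) *\<^sub>R u3 + (B 3 4 $ 4) *\<^sub>R u4"
  shows "lie_isomorphic br (bracket_from T)"
proof -
  let ?f = "frame_of u1 u2 u3 u4"
  have r: "range ?f = {u1, u2, u3, u4}" by (simp add: UNIV_4)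
  have "range e \<subseteq> span (range ?f)" unfolding r by (simp add: UNIV_4 span)
  then have f: "is_basis ?f" by (rule is_basis_if_spans[OF basis_frame])
  let ?E = "\<lambda>i j. br (?f i) (?f j) = (\<Sum>k\<in>UNIV. B i j $ k *\<^sub>R ?f k)"
  have less: "?E 1 2" "?E 1 3" "?E 1 4" "?E 2 3" "?E 2 4" "?E 3 4"
    by (simp_all add: sum_4 eq)
  have swap: "?E i j \<Longrightarrow> ?E j i" for i j
    by (simp add: br_swap[of "?f j" "?f i"] B_def bracket_from_swap[of T "std j" "std i"] sum_negf)
  have B0: "B i i = 0" for i using bracket_from_swap[of T "std i" "std i"] by (simp add: B_def vec_eq_iff)
  have diag: "?E i i" for i by (simp add: B0)
  have "\<forall>i j. ?E i j" unfolding forall_4 using less less[THEN swap] diag by blast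
  then show ?thesis by (intro lie_isomorphic_bracket_from[OF bilinear_br f]) (simp add: B_def)
qed

lemmas model_simps = bracket_from_Cons bracket_from_Nil axis_def

text \<open>Here \<open>u, w, z\<close> span a Heisenberg algebra with centre \<open>z\<close>, on which \<open>h\<close> acts with the distinct
weights \<open>1, -1/2, 1/2\<close>. The components \<open>t z + r u\<close> that keep \<open>w\<close> from being an eigenvector can
therefore be absorbed, which is what the choice of \<open>w'\<close> does.\<close>

lemma lie_isomorphic_A4_9_minus_half:
  assumes span: "e 1 \<in> span {h, u, w, z}" "e 2 \<in> span {h, u, w, z}"
      "e 3 \<in> span {h, u, w, z}" "e 4 \<in> span {h, u, w, z}"
    and eq: "br h u = u" "br h w = (-1/2) *\<^sub>R w + t *\<^sub>R z + r *\<^sub>R u" "br h z = (1/2) *\<^sub>R z"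
      "br u w = z" "br u z = 0" "br w z = 0"
  shows "lie_isomorphic br A4_9_minus_half"
proof -
  define w' where "w' = w - t *\<^sub>R z - (2 * r / 3) *\<^sub>R u"
  have "{h, u, w, z} \<subseteq> span {z, u, w', - h}"
  proof -
    have "h = 0 *\<^sub>R z + 0 *\<^sub>R u + 0 *\<^sub>R w' + (-1) *\<^sub>R (- h)" by simp
    moreover have "w = t *\<^sub>R z + (2 * r / 3) *\<^sub>R u + 1 *\<^sub>R w' + 0 *\<^sub>R (- h)" by (simp add: w'_def)
    ultimately show ?thesis by (metis empty_subsetI insert_subset insertCI span_base span4I)
  qed
  then have sub: "span {h, u, w, z} \<subseteq> span {z, u, w', - h}"
    by (metis span_mono span_span)
  note rev = br_swap[of u h, unfolded eq] br_swap[of w h, unfolded eq] br_swap[of z h, unfolded eq]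
    br_swap[of w u, unfolded eq] br_swap[of z u, unfolded eq] br_swap[of z w, unfolded eq]
  have br': "br z u = 0" "br z w' = 0" "br z (- h) = (1/2) *\<^sub>R z" "br u w' = z" "br u (- h) = u"
    by (simp_all add: w'_def br_simps eq rev)
  have "br w' (- h) = (-1/2) *\<^sub>R w'"
    by (rule frame_eqI) (simp add: w'_def br_simps g_simps eq rev field_simps)
  note br' = br' this
  show ?thesis
    unfolding A4_9_minus_half_def
  proof (rule lie_isomorphicI[of z u w' "- h"])
    show "e 1 \<in> span {z, u, w', - h}" "e 2 \<in> span {z, u, w', - h}" "e 3 \<in> span {z, u, w', - h}"
      "e 4 \<in> span {z, u, w', - h}" using span sub by auto
  qed (simp_all add: model_simps br')
qed

end

section \<open>Algebras split into two orthogonal planes\<close>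

text \<open>The matrices of \<open>A\<close> and \<open>B\<close> are \<open>A\<^sub>3 = ((p1, p3), (p2, -p1))\<close>, \<open>A\<^sub>4 = ((q1, q3), (q2, -q1))\<close> in
the basis \<open>e\<^sub>1, e\<^sub>2\<close> and \<open>B\<^sub>1 = ((x1, x3), (x2, -x1))\<close>, \<open>B\<^sub>2 = ((y1, y3), (y2, -y1))\<close> in the basis
\<open>e\<^sub>3, e\<^sub>4\<close>, and the mixed brackets are \<open>[e\<^sub>i, e\<^sub>j] = A\<^sub>i e\<^sub>j - B\<^sub>j e\<^sub>i\<close> for \<open>i \<in> {3, 4}\<close>, \<open>j \<in> {1, 2}\<close>.\<close>

locale split_frame = metric_lie_algebra +
  fixes a c p1 p2 p3 q1 q2 q3 x1 x2 x3 y1 y2 y3 :: real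
  assumes
    br12: "br (e 1) (e 2) = a *\<^sub>R e 2" and
    br34: "br (e 3) (e 4) = c *\<^sub>R e 4" and
    br31: "br (e 3) (e 1) = p1 *\<^sub>R e 1 + p2 *\<^sub>R e 2 - x1 *\<^sub>R e 3 - x2 *\<^sub>R e 4" and
    br32: "br (e 3) (e 2) = p3 *\<^sub>R e 1 - p1 *\<^sub>R e 2 - y1 *\<^sub>R e 3 - y2 *\<^sub>R e 4" and
    br41: "br (e 4) (e 1) = q1 *\<^sub>R e 1 + q2 *\<^sub>R e 2 - x3 *\<^sub>R e 3 + x1 *\<^sub>R e 4" and
    br42: "br (e 4) (e 2) = q3 *\<^sub>R e 1 - q1 *\<^sub>R e 2 - y3 *\<^sub>R e 3 + y1 *\<^sub>R e 4"
begin

lemmas table = br12 br34 br31 br32 br41 br42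
  br_swap[of "e 2" "e 1", unfolded br12] br_swap[of "e 4" "e 3", unfolded br34]
  br_swap[of "e 1" "e 3", unfolded br31] br_swap[of "e 2" "e 3", unfolded br32]
  br_swap[of "e 1" "e 4", unfolded br41] br_swap[of "e 2" "e 4", unfolded br42]

lemma C_diag: "C i i k = 0"
  by (simp add: C_def g_simps)

lemma C_table:
  "C 1 2 = frame_of 0 a 0 0" "C 2 1 = frame_of 0 (- a) 0 0"
  "C 3 4 = frame_of 0 0 0 c" "C 4 3 = frame_of 0 0 0 (- c)"
  "C 3 1 = frame_of p1 p2 (- x1) (- x2)" "C 1 3 = frame_of (- p1) (- p2) x1 x2"
  "C 3 2 = frame_of p3 (- p1) (- y1) (- y2)" "C 2 3 = frame_of (- p3) p1 y1 y2"
  "C 4 1 = frame_of q1 q2 (- x3) x1" "C 1 4 = frame_of (- q1) (- q2) x3 (- x1)"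
  "C 4 2 = frame_of q3 (- q1) (- y3) y1" "C 2 4 = frame_of (- q3) q1 y3 (- y1)"
  by (simp_all add: fun_eq_iff forall_4 C_def table g_simps g_frame)

text \<open>The Jacobi identity in components: \<open>A\<close> and \<open>B\<close> are representations, \<open>[A\<^sub>3, A\<^sub>4] = c A\<^sub>4\<close> and
\<open>[B\<^sub>1, B\<^sub>2] = a B\<^sub>2\<close>, and they match, \<open>a A\<^sub>z e\<^sub>2 = A\<^sub>u e\<^sub>1 - A\<^sub>v e\<^sub>2\<close> with \<open>u = B\<^sub>2 z\<close>, \<open>v = B\<^sub>1 z\<close> for \<open>z \<in> Q\<close>,
and the same with the roles of \<open>P\<close> and \<open>Q\<close> exchanged. Trace-freeness enters when \<open>A\<^sub>z\<close> is moved
across the bracket of \<open>P\<close>.\<close>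

lemma jacobi_rep_A:
  "p3 * q2 - q3 * p2 = c * q1" "2 * (p1 * q3 - q1 * p3) = c * q3" "2 * (p2 * q1 - p1 * q2) = c * q2"
  using jacobi_frame[of 3 4 1 1] jacobi_frame[of 3 4 2 1] jacobi_frame[of 3 4 1 2]
  by (simp_all add: sum_4 C_table C_diag algebra_simps)

lemma jacobi_rep_B:
  "x3 * y2 - y3 * x2 = a * y1" "2 * (x1 * y3 - y1 * x3) = a * y3" "2 * (x2 * y1 - x1 * y2) = a * y2"
  using jacobi_frame[of 1 2 3 3] jacobi_frame[of 1 2 4 3] jacobi_frame[of 1 2 3 4]
  by (simp_all add: sum_4 C_table C_diag algebra_simps)

lemma jacobi_match_A:
  "a * p3 = y1 * p1 + y2 * q1 - x1 * p3 - x2 * q3"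
  "- a * p1 = y1 * p2 + y2 * q2 + x1 * p1 + x2 * q1"
  "a * q3 = y3 * p1 - y1 * q1 - x3 * p3 + x1 * q3"
  "- a * q1 = y3 * p2 - y1 * q2 + x3 * p1 - x1 * q1"
  using jacobi_frame[of 3 1 2 1] jacobi_frame[of 3 1 2 2] jacobi_frame[of 4 1 2 1] jacobi_frame[of 4 1 2 2]
  by (simp_all add: sum_4 C_table C_diag algebra_simps)

lemma jacobi_match_B:
  "c * x3 = q1 * x1 + q2 * y1 - p1 * x3 - p2 * y3"
  "- c * x1 = q1 * x2 + q2 * y2 + p1 * x1 + p2 * y1"
  "c * y3 = q3 * x1 - q1 * y1 - p3 * x3 + p1 * y3"
  "- c * y1 = q3 * x2 - q1 * y2 + p3 * x1 - p1 * y1"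
  using jacobi_frame[of 1 3 4 3] jacobi_frame[of 1 3 4 4] jacobi_frame[of 2 3 4 3] jacobi_frame[of 2 3 4 4]
  by (simp_all add: sum_4 C_table C_diag algebra_simps)

text \<open>The mixed bracket \<open>[e\<^sub>3, e\<^sub>1] = p2 e\<^sub>2 - x2 e\<^sub>4\<close> is removed by adding multiples of \<open>e\<^sub>4\<close> to \<open>e\<^sub>1\<close>
and of \<open>e\<^sub>2\<close> to \<open>e\<^sub>3\<close>.\<close>

lemma lie_isomorphic_two_A2_if:
  assumes "a \<noteq> 0" "c \<noteq> 0" "p1 = 0" "p3 = 0" "q1 = 0" "q2 = 0" "q3 = 0"
    "x1 = 0" "x3 = 0" "y1 = 0" "y2 = 0" "y3 = 0"
  shows "lie_isomorphic br two_A2"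
proof -
  define u1 u3 where "u1 = (1 / a) *\<^sub>R e 1 + (x2 / (a * c)) *\<^sub>R e 4"
    and "u3 = (1 / c) *\<^sub>R e 3 + (p2 / (a * c)) *\<^sub>R e 2"
  have "e 1 = a *\<^sub>R u1 + 0 *\<^sub>R e 2 + 0 *\<^sub>R u3 + (- x2 / c) *\<^sub>R e 4"
    "e 2 = 0 *\<^sub>R u1 + 1 *\<^sub>R e 2 + 0 *\<^sub>R u3 + 0 *\<^sub>R e 4"
    "e 3 = 0 *\<^sub>R u1 + (- p2 / a) *\<^sub>R e 2 + c *\<^sub>R u3 + 0 *\<^sub>R e 4"
    "e 4 = 0 *\<^sub>R u1 + 0 *\<^sub>R e 2 + 0 *\<^sub>R u3 + 1 *\<^sub>R e 4"
    using assms by (simp_all add: u1_def u3_def algebra_simps)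
  note span = this[THEN span4I]
  show ?thesis
    unfolding two_A2_def
    by (rule lie_isomorphicI[OF span]; rule frame_eqI4)
      (use assms in \<open>simp_all add: model_simps u1_def u3_def br_simps g_simps table g_frame field_simps\<close>)
qed

lemma lie_isomorphic_A2_plus_2A1_if:
  assumes "a \<noteq> 0" "c = 0" "p1 = 0" "p2 = 0" "p3 = 0" "q1 = 0" "q2 = 0" "q3 = 0"
    "x1 = 0" "x2 = 0" "x3 = 0" "y1 = 0" "y2 = 0" "y3 = 0"
  shows "lie_isomorphic br A2_plus_2A1"
proof -
  have "e 1 = a *\<^sub>R ((1 / a) *\<^sub>R e 1) + 0 *\<^sub>R e 2 + 0 *\<^sub>R e 3 + 0 *\<^sub>R e 4"
    "e 2 = 0 *\<^sub>R ((1 / a) *\<^sub>R e 1) + 1 *\<^sub>R e 2 + 0 *\<^sub>R e 3 + 0 *\<^sub>R e 4"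
    "e 3 = 0 *\<^sub>R ((1 / a) *\<^sub>R e 1) + 0 *\<^sub>R e 2 + 1 *\<^sub>R e 3 + 0 *\<^sub>R e 4"
    "e 4 = 0 *\<^sub>R ((1 / a) *\<^sub>R e 1) + 0 *\<^sub>R e 2 + 0 *\<^sub>R e 3 + 1 *\<^sub>R e 4"
    using assms by simp_all
  note span = this[THEN span4I]
  show ?thesis
    unfolding A2_plus_2A1_def
    by (rule lie_isomorphicI[OF span]; rule frame_eqI4)
      (use assms in \<open>simp_all add: model_simps br_simps g_simps table g_frame\<close>)
qed

lemma lie_isomorphic_A4_6_0_if:
  assumes "a \<noteq> 0" "x2 \<noteq> 0" "x3 = - x2" "c = 0" "p1 = 0" "p2 = 0" "p3 = 0" "q1 = 0" "q2 = 0" "q3 = 0"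
    "x1 = 0" "y1 = 0" "y2 = 0" "y3 = 0"
  shows "lie_isomorphic br (A4_6_0 (- a / x2))"
proof -
  have "e 1 = 0 *\<^sub>R e 2 + 0 *\<^sub>R e 3 + 0 *\<^sub>R e 4 + x2 *\<^sub>R ((1 / x2) *\<^sub>R e 1)"
    "e 2 = 1 *\<^sub>R e 2 + 0 *\<^sub>R e 3 + 0 *\<^sub>R e 4 + 0 *\<^sub>R ((1 / x2) *\<^sub>R e 1)"
    "e 3 = 0 *\<^sub>R e 2 + 1 *\<^sub>R e 3 + 0 *\<^sub>R e 4 + 0 *\<^sub>R ((1 / x2) *\<^sub>R e 1)"
    "e 4 = 0 *\<^sub>R e 2 + 0 *\<^sub>R e 3 + 1 *\<^sub>R e 4 + 0 *\<^sub>R ((1 / x2) *\<^sub>R e 1)"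
    using assms by simp_all
  note span = this[THEN span4I]
  show ?thesis
    unfolding A4_6_0_def
    by (rule lie_isomorphicI[OF span]; rule frame_eqI4)
      (use assms in \<open>simp_all add: model_simps br_simps g_simps table g_frame\<close>)
qed

end

section \<open>Classification of split frames\<close>

context split_frame begin

text \<open>From \<open>[B\<^sub>1, B\<^sub>2] = a B\<^sub>2\<close> one gets \<open>a tr B\<^sub>2\<^sup>2 = tr([B\<^sub>1, B\<^sub>2] B\<^sub>2) = 0\<close>, and \<open>tr B\<^sub>2\<^sup>2 / 2\<close> is the
polynomial here.\<close>

lemma nilpotent_B: "a * (y1\<^sup>2 + y2 * y3) = 0"
  using jacobi_rep_B by algebra

text \<open>If \<open>c = 0\<close>, \<open>A\<^sub>4 = 0\<close> and \<open>B\<^sub>2 \<noteq> 0\<close>, then \<open>e\<^sub>2\<close>, a vector \<open>w \<in> Q\<close> outside the kernel of the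
nilpotent \<open>B\<^sub>2\<close> and \<open>z = B\<^sub>2 w\<close> span a Heisenberg algebra with weights \<open>1, -1/2, 1/2\<close> under \<open>e\<^sub>1 / a\<close>.
Here \<open>w = e\<^sub>4\<close>; the next lemma takes \<open>w = e\<^sub>3\<close>.\<close>

lemma A4_9_if_y3:
  assumes "a \<noteq> 0" "c = 0" "p1 = 0" "p2 = 0" "p3 = 0" "q1 = 0" "q2 = 0" "q3 = 0" "y3 \<noteq> 0"
  shows "lie_isomorphic br A4_9_minus_half"
proof -
  define h u w z where "h = (1 / a) *\<^sub>R e 1" and "u = e 2" and "w = e 4" and "z = y3 *\<^sub>R e 3 - y1 *\<^sub>R e 4"
  have nil: "y1\<^sup>2 + y2 * y3 = 0" using nilpotent_B assms by simp
  have "e 1 = a *\<^sub>R h + 0 *\<^sub>R u + 0 *\<^sub>R w + 0 *\<^sub>R z"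
    "e 2 = 0 *\<^sub>R h + 1 *\<^sub>R u + 0 *\<^sub>R w + 0 *\<^sub>R z"
    "e 3 = 0 *\<^sub>R h + 0 *\<^sub>R u + (y1 / y3) *\<^sub>R w + (1 / y3) *\<^sub>R z"
    "e 4 = 0 *\<^sub>R h + 0 *\<^sub>R u + 1 *\<^sub>R w + 0 *\<^sub>R z"
    using assms by (simp_all add: h_def u_def w_def z_def algebra_simps)
  note span = this[THEN span4I]
  have r: "2 * (x1 * y3 - y1 * x3) = a * y3" "x3 * y2 - y3 * x2 = a * y1"
    using jacobi_rep_B by simp_all
  have k: "2 * (y3 * x2 + y1 * x1) = - a * y1"
  proof -
    have "y3 * (2 * (y3 * x2 + y1 * x1) + a * y1) = 0" using r nil by algebra
    then show ?thesis using \<open>y3 \<noteq> 0\<close> by simp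
  qed
  show ?thesis
  proof (rule lie_isomorphic_A4_9_minus_half[OF span, where t = "x3 / (a * y3)" and r = 0])
    show "br h u = u" "br u w = z" "br w z = 0"
      by (rule frame_eqI4; simp add: h_def u_def w_def z_def br_simps g_simps table g_frame assms)+
    show "br u z = 0"
      by (rule frame_eqI4; use nil in \<open>simp add: u_def z_def br_simps g_simps table g_frame assms power2_eq_square algebra_simps\<close>)
    show "br h w = (- 1 / 2) *\<^sub>R w + (x3 / (a * y3)) *\<^sub>R z + 0 *\<^sub>R u"
      by (rule frame_eqI4; use r assms in \<open>simp add: h_def u_def w_def z_def br_simps g_simps table g_frame field_simps\<close>)
    show "br h z = (1 / 2) *\<^sub>R z"
      by (rule frame_eqI4; use r k assms in \<open>simp add: h_def u_def w_def z_def br_simps g_simps table g_frame field_simps\<close>)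
  qed
qed

lemma A4_9_if_y2:
  assumes "a \<noteq> 0" "c = 0" "p1 = 0" "p3 = 0" "q1 = 0" "q2 = 0" "q3 = 0" "y1 = 0" "y3 = 0" "y2 \<noteq> 0"
  shows "lie_isomorphic br A4_9_minus_half"
proof -
  have "(2 * x1 + a) * y2 = 0" "x3 * y2 = 0"
    using jacobi_rep_B assms by (simp_all add: algebra_simps)
  then have r: "x3 = 0" "x1 = - a / 2" using assms by auto
  define h u w z where "h = (1 / a) *\<^sub>R e 1" and "u = e 2" and "w = e 3" and "z = y2 *\<^sub>R e 4"
  have "e 1 = a *\<^sub>R h + 0 *\<^sub>R u + 0 *\<^sub>R w + 0 *\<^sub>R z"
    "e 2 = 0 *\<^sub>R h + 1 *\<^sub>R u + 0 *\<^sub>R w + 0 *\<^sub>R z"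
    "e 3 = 0 *\<^sub>R h + 0 *\<^sub>R u + 1 *\<^sub>R w + 0 *\<^sub>R z"
    "e 4 = 0 *\<^sub>R h + 0 *\<^sub>R u + 0 *\<^sub>R w + (1 / y2) *\<^sub>R z"
    using assms by (simp_all add: h_def u_def w_def z_def)
  note span = this[THEN span4I]
  show ?thesis
    by (rule lie_isomorphic_A4_9_minus_half[OF span, where t = "x2 / (a * y2)" and r = "- p2 / a"];
      rule frame_eqI4;
      simp add: assms r h_def u_def w_def z_def br_simps g_simps table g_frame field_simps)
qed

text \<open>The vector \<open>c e\<^sub>1 - a e\<^sub>3\<close> acts on the abelian subalgebra \<open>\<langle>e\<^sub>2, e\<^sub>4\<rangle>\<close> without trace, and
nilpotently: its determinant there is a multiple of \<open>q2 y2 - a c / 4\<close>. With \<open>e\<^sub>2\<close> it generates a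
Heisenberg ideal.\<close>

lemma A4_9_if_q2:
  assumes "a \<noteq> 0" "c \<noteq> 0" "p1 = - c / 2" "p3 = 0" "q1 = 0" "q3 = 0" "x1 = - a / 2" "x3 = 0"
    "y1 = 0" "y3 = 0" "q2 * y2 = a * c / 4"
  shows "lie_isomorphic br A4_9_minus_half"
proof -
  have y: "y2 \<noteq> 0" using assms by auto
  define h u w z where "h = (1 / a) *\<^sub>R e 1" and "u = e 2" and "w = c *\<^sub>R e 1 - a *\<^sub>R e 3"
    and "z = (- (a * c) / 2) *\<^sub>R e 2 - (a * y2) *\<^sub>R e 4"
  have "e 1 = a *\<^sub>R h + 0 *\<^sub>R u + 0 *\<^sub>R w + 0 *\<^sub>R z"
    "e 2 = 0 *\<^sub>R h + 1 *\<^sub>R u + 0 *\<^sub>R w + 0 *\<^sub>R z"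
    "e 3 = c *\<^sub>R h + 0 *\<^sub>R u + (- 1 / a) *\<^sub>R w + 0 *\<^sub>R z"
    "e 4 = 0 *\<^sub>R h + (- c / (2 * y2)) *\<^sub>R u + 0 *\<^sub>R w + (- 1 / (a * y2)) *\<^sub>R z"
    by (rule frame_eqI4; use assms y in \<open>simp add: h_def u_def w_def z_def g_simps g_frame field_simps\<close>)+
  note span = this[THEN span4I]
  have q: "q2 * y2 * 4 = a * c" using assms by simp
  show ?thesis
    by (rule lie_isomorphic_A4_9_minus_half[OF span, where t = "x2 / (a * y2)" and r = "p2 + c * x2 / (2 * y2)"];
      rule frame_eqI4;
      use q in \<open>simp add: assms(1-10) y h_def u_def w_def z_def br_simps g_simps table g_frame field_simps\<close>)
qed

text \<open>In the next three lemmas the algebra is an extension of \<open>\<real>\<close> by an abelian ideal \<open>\<real>\<^sup>3\<close>. If \<open>D\<close>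
is the action of the unit normal of the ideal, \<open>S\<close> its symmetric part and \<open>u\<close> this normal, then
\<open>Ric(u, u) = -tr S\<^sup>2\<close>, \<open>Ric(u, v) = 0\<close> for \<open>v\<close> in the ideal and \<open>Ric = [D, D\<^sup>T] / 2 - tr(D) S\<close> on the
ideal; this is where the sums of squares come from.\<close>

lemma ricci_one_nonabelian:
  assumes "q1 = 0" "q2 = 0" "q3 = 0" "y1 = 0" "y2 = 0" "y3 = 0" "p1 = 0" "p3 = 0" "c = 0"
  shows "ricci b br g (e 1) (e 1) - ricci b br g (e 2) (e 2) = - (p2\<^sup>2 + 2 * x1\<^sup>2 + (x2 + x3)\<^sup>2 / 2)"
    "ricci b br g (e 1) (e 1) - ricci b br g (e 3) (e 3) = - (a\<^sup>2 + 2 * x1\<^sup>2 + x3 * (x2 + x3)) + a * x1"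
  by (simp_all add: ricci_frame sum_4 \<Gamma>_def C_table C_diag assms power2_eq_square field_simps)

lemma ricci_abelian:
  assumes "q1 = 0" "q2 = 0" "q3 = 0" "y1 = 0" "y2 = 0" "y3 = 0" "x1 = 0" "x3 = 0" "a = 0" "c = 0"
  shows "ricci b br g (e 3) (e 3) - ricci b br g (e 4) (e 4) = - (x2\<^sup>2 + 2 * p1\<^sup>2 + (p2 + p3)\<^sup>2 / 2)"
    "ricci b br g (e 1) (e 1) - ricci b br g (e 3) (e 3) = 2 * p1\<^sup>2 + p3 * (p2 + p3)"
  by (simp_all add: ricci_frame sum_4 \<Gamma>_def C_table C_diag assms power2_eq_square field_simps)

text \<open>The ideal is spanned by \<open>c e\<^sub>1 - a e\<^sub>3\<close>, \<open>e\<^sub>2\<close> and \<open>e\<^sub>4\<close>, and its normal is a multiple of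
\<open>a e\<^sub>1 + c e\<^sub>3\<close>. The identity says that \<open>Ric(a e\<^sub>1 + c e\<^sub>3, c e\<^sub>1 - a e\<^sub>3) = 0\<close>.\<close>

lemma ricci_diagonal:
  assumes "q1 = 0" "q2 = 0" "q3 = 0" "y1 = 0" "y2 = 0" "y3 = 0" "p3 = 0" "x3 = 0" "p1 = - c" "x1 = - a"
  shows "a * c * (ricci b br g (e 1) (e 1) - ricci b br g (e 3) (e 3)) + (c\<^sup>2 - a\<^sup>2) * ricci b br g (e 1) (e 3) = 0"
  by (simp add: ricci_frame sum_4 \<Gamma>_def C_table C_diag assms power2_eq_square field_simps)

text \<open>Assume \<open>A\<^sub>4 e\<^sub>2\<close> is not a multiple of \<open>e\<^sub>2\<close>. The nilpotent \<open>A\<^sub>4\<close> then has a kernel vector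
\<open>e\<^sub>1 + k e\<^sub>2\<close>, and with \<open>U = B\<^sub>1 + k B\<^sub>2\<close> in place of \<open>B\<^sub>1\<close> the compatibility condition determines
\<open>u3 = 0\<close>, \<open>u1 = -a\<close> and \<open>y3 \<noteq> 0\<close>. But \<open>[U, B\<^sub>2] = a B\<^sub>2\<close> asks for \<open>u1 = a / 2\<close>.\<close>

lemma q3_eq_0_if_nonabelian:
  assumes "a \<noteq> 0" "c \<noteq> 0"
  shows "q3 = 0"
proof (rule ccontr)
  assume q3: "q3 \<noteq> 0"
  define k where "k = - q1 / q3"
  define u1 u2 u3 where "u1 = x1 + k * y1" and "u2 = x2 + k * y2" and "u3 = x3 + k * y3"
  have "c * (q1\<^sup>2 + q2 * q3) = 0" using jacobi_rep_A by algebra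
  then have nil: "q1\<^sup>2 + q2 * q3 = 0" using assms by simp
  have q1: "q1 = - k * q3" using q3 by (simp add: k_def)
  have "q3 * (q2 + k\<^sup>2 * q3) = 0" using nil unfolding q1 by (simp add: power2_eq_square algebra_simps)
  then have q2: "q2 = - k\<^sup>2 * q3" using q3 by simp
  have "q3 * (2 * p1 - c + 2 * k * p3) = 0" using jacobi_rep_A(2) unfolding q1 by (simp add: algebra_simps)
  then have p1: "2 * p1 = c - 2 * k * p3" using q3 by simp
  have "q3 * (p2 - c * k + k\<^sup>2 * p3) = 0" using jacobi_rep_A(1) unfolding q1 q2 by (simp add: algebra_simps)
  then have p2: "p2 = c * k - k\<^sup>2 * p3" using q3 by simp
  have "c * u3 = 0"
    using jacobi_match_A(3,4) p1 unfolding q1 q2 p2 u3_def by algebra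
  then have u3: "u3 = 0" using assms by simp
  have "c * (u1 + a) = 0"
    using jacobi_match_A(1,2) p1 unfolding q1 q2 p2 u1_def by algebra
  then have u1: "u1 = - a" using assms by simp
  have "c * y3 = 4 * a * q3"
    using jacobi_match_A(3) p1 u1 u3 unfolding q1 u1_def u3_def by algebra
  then have y3: "y3 \<noteq> 0" using assms q3 by auto
  have "2 * (u1 * y3 - y1 * u3) = a * y3"
    using jacobi_rep_B(2) unfolding u1_def u3_def by (simp add: algebra_simps)
  then show False using u1 u3 y3 assms by simp
qed

text \<open>Exchanging \<open>P\<close> and \<open>Q\<close> exchanges \<open>A\<close> and \<open>B\<close> without a sign, since \<open>[x, z] = B\<^sub>x z - A\<^sub>z x\<close>.\<close>

lemma swapped_split_frame:
  "split_frame b g (frame_of (e 3) (e 4) (e 1) (e 2)) br c a x1 x2 x3 y1 y2 y3 p1 p2 p3 q1 q2 q3"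
proof -
  have "orthonormal_frame g (frame_of (e 3) (e 4) (e 1) (e 2))"
    by (simp add: orthonormal_frame_def forall_4 g_frame)
  then show ?thesis
    by unfold_locales (simp_all add: basis inner lie table)
qed

lemma classify_both_nonabelian:
  assumes ac: "a \<noteq> 0" "c \<noteq> 0"
    and ric: "ricci b br g (e 1) (e 3) = 0" "ricci b br g (e 1) (e 1) \<noteq> ricci b br g (e 3) (e 3)"
  shows "lie_isomorphic br two_A2 \<or> lie_isomorphic br A4_9_minus_half"
proof -
  interpret sw: split_frame b g "frame_of (e 3) (e 4) (e 1) (e 2)" br c a
    x1 x2 x3 y1 y2 y3 p1 p2 p3 q1 q2 q3
    by (rule swapped_split_frame)
  have q3: "q3 = 0" by (rule q3_eq_0_if_nonabelian[OF ac])
  have y3: "y3 = 0" using sw.q3_eq_0_if_nonabelian ac by simp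
  have q1: "q1 = 0" using jacobi_rep_A ac q3 by algebra
  have y1: "y1 = 0" using nilpotent_B ac y3 by simp
  note z = q3 y3 q1 y1
  have "x1 * p3 = 0" "(a + x1) * p3 = 0" "p1 * x3 = 0" "(c + p1) * x3 = 0"
    using jacobi_match_A jacobi_match_B by (simp_all add: z algebra_simps)
  then have p3: "p3 = 0" and x3: "x3 = 0" using ac by auto
  note z = z p3 x3
  have e: "q2 * (2 * p1 + c) = 0" "y2 * (2 * x1 + a) = 0"
    "y2 * q2 + p1 * (x1 + a) = 0" "q2 * y2 + x1 * (p1 + c) = 0"
    using jacobi_rep_A(3) jacobi_rep_B(3) jacobi_match_A(2) jacobi_match_B(2) by (simp_all add: z algebra_simps)
  show ?thesis
  proof (cases "q2 = 0")
    case q2: True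
    show ?thesis
    proof (cases "p1 = 0")
      case True
      then have "x1 = 0" using e(4) q2 ac by simp
      then have "y2 = 0" using e(2) ac by simp
      then show ?thesis using lie_isomorphic_two_A2_if True \<open>x1 = 0\<close> q2 z ac by simp
    next
      case False
      then have x1: "x1 = - a" using e(3) q2 by (simp add: add_eq_0_iff2)
      then have p1: "p1 = - c" using e(4) q2 ac by (simp add: add_eq_0_iff2)
      have "y2 = 0" using e(2) x1 ac by simp
      then have "a * c * (ricci b br g (e 1) (e 1) - ricci b br g (e 3) (e 3)) = 0"
        using ricci_diagonal q2 z x1 p1 ric(1) by simp
      then show ?thesis using ac ric(2) by simp
    qed
  next
    case q2: False
    then have p1: "p1 = - c / 2" using e(1) by simp
    have "c * (2 * x1 + a) = 0" using e(3,4) unfolding p1 by (simp add: field_simps)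
    then have x1: "x1 = - a / 2" using ac by simp
    have "q2 * y2 = a * c / 4" using e(4) unfolding p1 x1 by (simp add: field_simps)
    then show ?thesis using A4_9_if_q2 ac p1 x1 z by simp
  qed
qed

text \<open>When \<open>Q\<close> is abelian, \<open>A\<^sub>3\<close> and \<open>A\<^sub>4\<close> commute and are proportional; the hypothesis \<open>A\<^sub>4 = 0\<close> is met
after a rotation of \<open>Q\<close>.\<close>

lemma classify_one_nonabelian:
  assumes a: "a \<noteq> 0" and q: "c = 0" "q1 = 0" "q2 = 0" "q3 = 0"
    and ric: "ricci b br g (e 1) (e 1) = ricci b br g (e 2) (e 2)"
  shows "lie_isomorphic br A2_plus_2A1 \<or> (\<exists>\<alpha>. \<alpha> \<noteq> 0 \<and> lie_isomorphic br (A4_6_0 \<alpha>)) \<or>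
    lie_isomorphic br A4_9_minus_half"
proof -
  have p1: "p1 = 0" and p3: "p3 = 0"
    using jacobi_match_A jacobi_match_B a q by (simp_all add: algebra_simps)
  have p2: "p2 * y3 = 0" "p2 * y1 = 0"
    using jacobi_match_B p1 p3 q by simp_all
  show ?thesis
  proof (cases "y3 = 0")
    case False
    then show ?thesis using A4_9_if_y3 a q p1 p2 p3 by simp
  next
    case y3: True
    then have y1: "y1 = 0" using nilpotent_B a by simp
    show ?thesis
    proof (cases "y2 = 0")
      case False
      then show ?thesis using A4_9_if_y2 a q p1 p3 y1 y3 by simp
    next
      case y2: True
      have "p2\<^sup>2 + 2 * x1\<^sup>2 + (x2 + x3)\<^sup>2 / 2 = 0"
        using ricci_one_nonabelian(1) q y1 y2 y3 p1 p3 ric by simp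
      then have "p2 = 0 \<and> x1 = 0 \<and> x2 + x3 = 0"
        by (smt (verit) zero_le_power2 half_gt_zero power2_less_eq_zero_iff zero_less_divide_iff field_sum_of_halves)
      then have z: "p2 = 0" "x1 = 0" "x3 = - x2" by auto
      show ?thesis
      proof (cases "x2 = 0")
        case True
        then show ?thesis using lie_isomorphic_A2_plus_2A1_if a q z p1 p3 y1 y2 y3 by simp
      next
        case False
        then have "- a / x2 \<noteq> 0" using a by simp
        moreover have "lie_isomorphic br (A4_6_0 (- a / x2))"
          using lie_isomorphic_A4_6_0_if a q z p1 p3 y1 y2 y3 False by simp
        ultimately show ?thesis by blast
      qed
    qed
  qed
qed

text \<open>With \<open>A\<^sub>4 = B\<^sub>2 = 0\<close> the compatibility condition makes one of \<open>A\<^sub>3\<close>, \<open>B\<^sub>1\<close> strictly triangular,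
so that the algebra is an extension of \<open>\<real>\<close> by \<open>\<real>\<^sup>3\<close>. The acting endomorphism must be skew, and
the metric is flat.\<close>

lemma ricci_eq_if_abelian:
  assumes "a = 0" "c = 0" "q1 = 0" "q2 = 0" "q3 = 0" "y1 = 0" "y2 = 0" "y3 = 0"
    and ric: "ricci b br g (e 1) (e 1) = ricci b br g (e 2) (e 2)" "ricci b br g (e 3) (e 3) = ricci b br g (e 4) (e 4)"
  shows "ricci b br g (e 1) (e 1) = ricci b br g (e 3) (e 3)"
proof -
  have sq: "u = 0 \<and> v = 0 \<and> w = 0" if "u\<^sup>2 + 2 * v\<^sup>2 + w\<^sup>2 / 2 = 0" for u v w :: real
    using that by (smt (verit) zero_le_power2 half_gt_zero power2_less_eq_zero_iff zero_less_divide_iff field_sum_of_halves)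
  have "x1 * p3 = 0" "x1 * p1 = 0" "x3 * p3 = 0" "x3 * p1 = 0"
    using jacobi_match_A assms by simp_all
  then consider "p1 = 0" "p3 = 0" | "x1 = 0" "x3 = 0" by auto
  then show ?thesis
  proof cases
    case 1
    then have "x1 = 0 \<and> x2 + x3 = 0" using ricci_one_nonabelian(1) assms sq[of p2 x1 "x2 + x3"] by simp
    then show ?thesis using ricci_one_nonabelian(2) assms 1 by simp
  next
    case 2
    then have "p1 = 0 \<and> p2 + p3 = 0" using ricci_abelian(1) assms sq[of x2 p1 "p2 + p3"] by simp
    then show ?thesis using ricci_abelian(2) assms 2 by simp
  qed
qed

end

section \<open>From the Einstein-Maxwell equations to a splitting\<close>

text \<open>The conditions on a metric that remain once \<open>F\<close> is eliminated. They are phrased through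
plane forms rather than structure constants so that they are manifestly invariant under
rotations of each plane.\<close>

definition adapted_frame :: "(4 \<Rightarrow> 'a::real_vector) \<Rightarrow> ('a \<Rightarrow> 'a \<Rightarrow> 'a) \<Rightarrow> ('a \<Rightarrow> 'a \<Rightarrow> real) \<Rightarrow>
    (4 \<Rightarrow> 'a) \<Rightarrow> real \<Rightarrow> real \<Rightarrow> bool" where
  "adapted_frame b br g e l m \<longleftrightarrow> orthonormal_frame g e \<and>
     closed_form br (area_form g (e 1) (e 2)) \<and> closed_form br (area_form g (e 3) (e 4)) \<and>
     (\<forall>x y. ricci b br g x y = l * plane_metric g (e 1) (e 2) x y + m * plane_metric g (e 3) (e 4) x y)"

lemma closed_form_lincomb:
  assumes "closed_form br F" "closed_form br F'"
  shows "closed_form br (\<lambda>x y. p * F x y + q * F' x y)"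
proof -
  have "ext_deriv br (\<lambda>x y. p * F x y + q * F' x y) x y z = p * ext_deriv br F x y z + q * ext_deriv br F' x y z"
    for x y z by (simp add: ext_deriv_def algebra_simps)
  then show ?thesis using assms by (simp add: closed_form_def)
qed

context framed_space begin

abbreviation block_form :: "real \<Rightarrow> real \<Rightarrow> 'a \<Rightarrow> 'a \<Rightarrow> real" where
  "block_form p q \<equiv> \<lambda>x y. p * area_form g (e 1) (e 2) x y + q * area_form g (e 3) (e 4) x y"

abbreviation block_metric :: "real \<Rightarrow> real \<Rightarrow> 'a \<Rightarrow> 'a \<Rightarrow> real" where
  "block_metric l m \<equiv> \<lambda>x y. l * plane_metric g (e 1) (e 2) x y + m * plane_metric g (e 3) (e 4) x y"

lemma g_eq_block_metric: "g x y = block_metric 1 1 x y"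
  by (simp add: g_expand[of x y] sum_4 plane_metric_def)

lemma trace_free_block_metric:
  "trace_free b g (block_metric l m) x y = block_metric ((l - m) / 2) ((m - l) / 2) x y"
proof -
  have "metric_trace b g (block_metric l m) = 2 * l + 2 * m"
    by (subst metric_trace_frame[OF bilinear_lincomb[OF bilinear_plane_metric bilinear_plane_metric]])
      (simp add: sum_4 g_frame plane_metric_def)
  then show ?thesis by (simp add: trace_free_def g_eq_block_metric[of x y] field_simps)
qed

lemma form_comp_block_form:
  "form_comp b g (block_form p q) = block_metric (- p\<^sup>2) (- q\<^sup>2)"
  by (intro ext, subst form_comp_frame[OF bilinear_lincomb[OF bilinear_area_form bilinear_area_form]])
    (simp add: sum_4 area_form_def plane_metric_def g_frame algebra_simps power2_eq_square)

lemma two_form_block_form: "two_form (block_form p q)"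
  unfolding two_form_def
  by (intro conjI bilinear_lincomb bilinear_area_form) (simp add: area_form_def)

end

context metric_lie_algebra begin

lemma einstein_maxwell_if_adapted:
  assumes ad: "adapted_frame b br g e l m" and "l \<noteq> m"
  shows "\<exists>F. einstein_maxwell b br g F \<and> \<not> einstein b br g"
proof -
  \<comment> \<open>Only the sign of \<open>l - m\<close> decides which of the two area forms is used; all that matters is
  \<open>p\<^sup>2 - q\<^sup>2 = l - m\<close>.\<close>
  define p q where "p = sqrt (max (l - m) 0)" and "q = sqrt (max (m - l) 0)"
  have pq: "p\<^sup>2 - q\<^sup>2 = l - m" by (auto simp: p_def q_def max_def)
  have ric: "ricci b br g = block_metric l m" using ad by (intro ext) (simp add: adapted_frame_def)
  have ric0: "ricci0 b br g x y = block_metric ((l - m) / 2) ((m - l) / 2) x y" for x y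
    unfolding ricci0_def ric by (rule trace_free_block_metric)
  have closed: "closed_form br (block_form p q)" for p q
    using ad by (intro closed_form_lincomb) (auto simp: adapted_frame_def)
  obtain \<sigma> :: real where "\<sigma> * \<sigma> = 1" and h: "\<And>p q. hodge_star b g (block_form p q)
      = (\<lambda>x y. \<sigma> * (q * area_form g (e 1) (e 2) x y + p * area_form g (e 3) (e 4) x y))"
    by (rule hodge_star_area_forms) (rule that; assumption)
  have "closed_form br (hodge_star b g (block_form p q))"
    using closed[of "\<sigma> * q" "\<sigma> * p"] unfolding h by (simp add: algebra_simps)
  moreover have "ricci0 b br g x y = - trace_free b g (form_comp b g (block_form p q)) x y" for x y
    unfolding ric0 form_comp_block_form trace_free_block_metric using pq by algebra
  ultimately have "einstein_maxwell b br g (block_form p q)"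
    using inner two_form_block_form closed by (simp add: einstein_maxwell_def)
  moreover have "ricci0 b br g (e 1) (e 1) \<noteq> 0"
    using \<open>l \<noteq> m\<close> by (simp add: ric0 plane_metric_def g_frame)
  ultimately show ?thesis by (auto simp: einstein_def)
qed

text \<open>Non-Einstein means \<open>d = p\<^sup>2 - q\<^sup>2 \<noteq> 0\<close>, which is the determinant, up to sign, of the system
expressing \<open>F\<close> and \<open>\<star>F\<close> through the two area forms. Solving it shows that both area forms are
closed.\<close>

lemma adapted_if_einstein_maxwell_block:
  assumes em: "einstein_maxwell b br g (block_form p q)" and ne: "\<not> einstein b br g"
  shows "\<exists>l m. l \<noteq> m \<and> adapted_frame b br g e l m"
proof -
  define d where "d = p\<^sup>2 - q\<^sup>2"
  define s where "s = metric_trace b g (ricci b br g) / 4"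
  have ric0: "ricci0 b br g x y = block_metric (d / 2) (- d / 2) x y" for x y
  proof -
    have "ricci0 b br g x y = - trace_free b g (form_comp b g (block_form p q)) x y"
      using em by (simp add: einstein_maxwell_def)
    then show ?thesis unfolding form_comp_block_form trace_free_block_metric d_def by (simp add: field_simps)
  qed
  have d: "d \<noteq> 0" using ne by (auto simp: einstein_def ric0)
  have ric: "ricci b br g x y = block_metric (s + d / 2) (s - d / 2) x y" for x y
    using ric0[of x y] by (simp add: ricci0_def trace_free_def s_def g_eq_block_metric[of x y] algebra_simps)
  obtain \<sigma> :: real where s: "\<sigma> * \<sigma> = 1" and h: "\<And>p q. hodge_star b g (block_form p q)
      = (\<lambda>x y. \<sigma> * (q * area_form g (e 1) (e 2) x y + p * area_form g (e 3) (e 4) x y))"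
    by (rule hodge_star_area_forms) (rule that; assumption)
  have cl: "closed_form br (block_form p q)" "closed_form br (hodge_star b g (block_form p q))"
    using em by (auto simp: einstein_maxwell_def)
  have ab: "area_form g (e 1) (e 2) x y = (p / d) * block_form p q x y + (- \<sigma> * q / d) * hodge_star b g (block_form p q) x y"
    "area_form g (e 3) (e 4) x y = (- q / d) * block_form p q x y + (\<sigma> * p / d) * hodge_star b g (block_form p q) x y"
    for x y
  proof -
    define A B where "A = area_form g (e 1) (e 2) x y" and "B = area_form g (e 3) (e 4) x y"
    define X Y where "X = p * A + q * B" and "Y = \<sigma> * (q * A + p * B)"
    have "d * A = p * X - \<sigma> * q * Y" "d * B = - q * X + \<sigma> * p * Y"
      using s unfolding d_def X_def Y_def by algebra+
    then have "A = (p / d) * X + (- \<sigma> * q / d) * Y" "B = (- q / d) * X + (\<sigma> * p / d) * Y"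
      using d by (simp_all add: eq_divide_eq mult.commute flip: add_divide_distrib diff_divide_distrib)
    note this[unfolded X_def Y_def A_def B_def]
    then show "area_form g (e 1) (e 2) x y = (p / d) * block_form p q x y + (- \<sigma> * q / d) * hodge_star b g (block_form p q) x y"
      "area_form g (e 3) (e 4) x y = (- q / d) * block_form p q x y + (\<sigma> * p / d) * hodge_star b g (block_form p q) x y"
      unfolding h by simp_all
  qed
  have eq1: "area_form g (e 1) (e 2) = (\<lambda>x y. (p / d) * block_form p q x y + (- \<sigma> * q / d) * hodge_star b g (block_form p q) x y)"
    by (intro ext) (rule ab)
  have eq2: "area_form g (e 3) (e 4) = (\<lambda>x y. (- q / d) * block_form p q x y + (\<sigma> * p / d) * hodge_star b g (block_form p q) x y)"
    by (intro ext) (rule ab)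
  have ca: "closed_form br (area_form g (e 1) (e 2))" by (subst eq1) (rule closed_form_lincomb[OF cl])
  have cb: "closed_form br (area_form g (e 3) (e 4))" by (subst eq2) (rule closed_form_lincomb[OF cl])
  have "s + d / 2 \<noteq> s - d / 2" using d by simp
  then show ?thesis using frame ric ca cb unfolding adapted_frame_def by blast
qed

end

context framed_space begin

text \<open>Compactness of the set of orthonormal pairs, transported to \<open>\<real>\<^sup>4\<close> because the ambient
space carries no topology.\<close>

lemma two_form_max_pair:
  assumes F: "two_form F"
  obtains u v where "g u u = 1" "g v v = 1" "g u v = 0"
    "\<And>x y. g x x = 1 \<Longrightarrow> g y y = 1 \<Longrightarrow> g x y = 0 \<Longrightarrow> F x y \<le> F u v"
proof -
  have bF: "bilinear F" using F by (simp add: two_form_def)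
  define \<phi> where "\<phi> v = (\<Sum>i\<in>UNIV. v $ i *\<^sub>R e i)" for v :: "real^4"
  define K where "K = {w :: (real^4) \<times> (real^4). fst w \<bullet> fst w = 1 \<and> snd w \<bullet> snd w = 1 \<and> fst w \<bullet> snd w = 0}"
  have gphi: "g (\<phi> v) (\<phi> w) = v \<bullet> w" for v w
    unfolding \<phi>_def bilinear_sum_sum[OF bilinear_g] by (simp add: g_frame inner_vec_def sum_4)
  have phi_frame_coords: "\<phi> (frame_coords x) = x" for x
    unfolding \<phi>_def frame_coords_def using frame_expand[of x] by simp
  have frame_coords_inner: "frame_coords x \<bullet> frame_coords y = g x y" for x y
    using gphi[of "frame_coords x" "frame_coords y"] by (simp add: phi_frame_coords)
  have "closed K"
    unfolding K_def by (intro closed_Collect_conj closed_Collect_eq continuous_intros)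
  moreover have "bounded K"
  proof -
    have "K \<subseteq> cball 0 1 \<times> cball 0 1" by (auto simp: K_def norm_eq_sqrt_inner)
    then show ?thesis using bounded_Times[OF bounded_cball bounded_cball] bounded_subset by blast
  qed
  ultimately have cpt: "compact K" by (simp add: compact_eq_bounded_closed)
  have "(axis 1 1, axis 2 1) \<in> K" by (simp add: K_def inner_axis_axis)
  then have ne: "K \<noteq> {}" by blast
  have "continuous_on K (\<lambda>w. F (\<phi> (fst w)) (\<phi> (snd w)))"
    unfolding \<phi>_def bilinear_sum_sum[OF bF] by (intro continuous_intros)
  from continuous_attains_sup[OF cpt ne this] obtain w where w: "w \<in> K" "\<And>w'. w' \<in> K \<Longrightarrow> F (\<phi> (fst w')) (\<phi> (snd w')) \<le> F (\<phi> (fst w)) (\<phi> (snd w))"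
    by blast
  show thesis
  proof (rule that[of "\<phi> (fst w)" "\<phi> (snd w)"])
    show "g (\<phi> (fst w)) (\<phi> (fst w)) = 1" "g (\<phi> (snd w)) (\<phi> (snd w)) = 1" "g (\<phi> (fst w)) (\<phi> (snd w)) = 0"
      using w(1) by (simp_all add: gphi K_def)
    fix x y assume "g x x = 1" "g y y = 1" "g x y = 0"
    then have "(frame_coords x, frame_coords y) \<in> K" by (simp add: K_def frame_coords_inner)
    from w(2)[OF this] show "F x y \<le> F (\<phi> (fst w)) (\<phi> (snd w))" by (simp add: phi_frame_coords)
  qed
qed

text \<open>Take for \<open>P\<close> the plane on which \<open>F\<close> is largest. Rotating one of the two maximising vectors
towards a unit vector \<open>w\<close> orthogonal to \<open>P\<close> cannot increase \<open>F\<close>, so \<open>F\<close> has no mixed components.\<close>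

lemma two_form_normal_form:
  assumes F: "two_form F"
  obtains e' p q where "orthonormal_frame g e'"
    "F = (\<lambda>x y. p * area_form g (e' 1) (e' 2) x y + q * area_form g (e' 3) (e' 4) x y)"
proof -
  have bF: "bilinear F" and alt: "F x x = 0" for x using F by (simp_all add: two_form_def)
  note F_simps = bilinear_ladd[OF bF] bilinear_radd[OF bF] bilinear_lmul[OF bF] bilinear_rmul[OF bF]
  have F_swap: "F y x = - F x y" for x y
  proof -
    have "F (x + y) (x + y) = F x y + F y x" unfolding F_simps by (simp add: alt)
    then show ?thesis by (simp add: alt)
  qed
  obtain u v where uv: "g u u = 1" "g v v = 1" "g u v = 0"
    and mx: "\<And>x y. g x x = 1 \<Longrightarrow> g y y = 1 \<Longrightarrow> g x y = 0 \<Longrightarrow> F x y \<le> F u v"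
    by (rule two_form_max_pair[OF F]) (rule that; assumption)
  have vu: "g v u = 0" using uv sym_g by metis
  \<comment> \<open>A linear function on the circle attains its maximum in the direction \<open>(\<alpha>, \<beta>)\<close> only.\<close>
  have key: "\<beta> = 0" if "\<And>s t. s\<^sup>2 + t\<^sup>2 = 1 \<Longrightarrow> s * \<alpha> + t * \<beta> \<le> \<alpha>" for \<alpha> \<beta> :: real
  proof (rule ccontr)
    assume b: "\<beta> \<noteq> 0"
    define \<rho> where "\<rho> = sqrt (\<alpha>\<^sup>2 + \<beta>\<^sup>2)"
    have r2: "\<rho>\<^sup>2 = \<alpha>\<^sup>2 + \<beta>\<^sup>2" by (simp add: \<rho>_def)
    have pos: "\<rho> > 0" using b by (simp add: \<rho>_def sum_power2_gt_zero_iff)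
    have "(\<alpha> / \<rho>)\<^sup>2 + (\<beta> / \<rho>)\<^sup>2 = 1"
      using pos r2[symmetric] by (simp add: power_divide flip: add_divide_distrib)
    from that[OF this] have "\<rho> * \<rho> \<le> \<alpha> * \<rho>"
      using pos r2 by (simp add: power2_eq_square field_simps)
    then have "\<rho> \<le> \<alpha>" using pos by simp
    then have "\<rho>\<^sup>2 \<le> \<alpha>\<^sup>2" using pos by (intro power_mono) auto
    then show False using r2 b by simp
  qed
  have perp: "F u w = 0 \<and> F v w = 0" if w: "g w w = 1" "g u w = 0" "g v w = 0" for w
  proof
    have w': "g w u = 0" "g w v = 0" using w sym_g by metis+
    show "F u w = 0"
    proof (rule key[of "F u v"])
      fix s t :: real assume "s\<^sup>2 + t\<^sup>2 = 1"
      then have "F u (s *\<^sub>R v + t *\<^sub>R w) \<le> F u v"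
        using uv vu w w' by (intro mx) (simp_all add: g_simps power2_eq_square)
      then show "s * F u v + t * F u w \<le> F u v" by (simp add: F_simps)
    qed
    have "F w v = 0"
    proof (rule key[of "F u v"])
      fix s t :: real assume "s\<^sup>2 + t\<^sup>2 = 1"
      then have "F (s *\<^sub>R u + t *\<^sub>R w) v \<le> F u v"
        using uv vu w w' by (intro mx) (simp_all add: g_simps power2_eq_square)
      then show "s * F u v + t * F w v \<le> F u v" by (simp add: F_simps)
    qed
    then show "F v w = 0" by (simp add: F_swap[of v w])
  qed
  obtain e' where e': "orthonormal_frame g e'" "e' 1 = u" "e' 2 = v"
    using orthonormal_complete[OF basis inner uv] by metis
  interpret n: framed_space b g e' by unfold_locales (rule basis inner e')+
  have p: "F (e' 1) (e' 3) = 0" "F (e' 2) (e' 3) = 0" "F (e' 1) (e' 4) = 0" "F (e' 2) (e' 4) = 0"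
    using perp[of "e' 3"] perp[of "e' 4"] by (simp_all add: n.g_frame flip: e'(2,3))
  let ?G = "\<lambda>x y. F (e' 1) (e' 2) * area_form g (e' 1) (e' 2) x y + F (e' 3) (e' 4) * area_form g (e' 3) (e' 4) x y"
  have eq: "\<forall>i j. F (e' i) (e' j) = ?G (e' i) (e' j)"
    unfolding forall_4
    by (simp add: p alt area_form_def n.g_frame F_swap[of "e' 3" "e' 1"] F_swap[of "e' 3" "e' 2"]
        F_swap[of "e' 4" "e' 1"] F_swap[of "e' 4" "e' 2"] F_swap[of "e' 2" "e' 1"] F_swap[of "e' 4" "e' 3"])
  have "F = ?G"
    by (intro ext, rule bilinear_on_basis[OF bF bilinear_lincomb[OF bilinear_area_form bilinear_area_form] n.basis_frame])
      (rule eq[rule_format])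
  then show thesis by (rule that[OF e'(1)])
qed

end

lemma adapted_frame_if_einstein_maxwell:
  assumes "lie_bracket br" "is_basis b" and em: "einstein_maxwell b br g F" and ne: "\<not> einstein b br g"
  obtains e l m where "l \<noteq> m" "adapted_frame b br g e l m"
proof -
  have g: "inner_product g" and F: "two_form F" using em by (auto simp: einstein_maxwell_def)
  obtain e0 where e0: "orthonormal_frame g e0"
    by (rule orthonormal_frame_exists[OF assms(2) g]) (rule that; assumption)
  interpret framed_space b g e0 by unfold_locales (rule assms g e0)+
  obtain e p q where e: "orthonormal_frame g e"
    and Feq: "F = (\<lambda>x y. p * area_form g (e 1) (e 2) x y + q * area_form g (e 3) (e 4) x y)"
    by (rule two_form_normal_form[OF F]) (rule that; assumption)
  interpret n: metric_lie_algebra b g e br by unfold_locales (rule assms g e)+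
  show thesis
    using n.adapted_if_einstein_maxwell_block[OF em[unfolded Feq] ne] that by blast
qed

section \<open>Normalising an adapted frame\<close>

lemma rotated_plane:
  assumes "bilinear g" and st: "s\<^sup>2 + t\<^sup>2 = 1"
  shows "area_form g (s *\<^sub>R u + t *\<^sub>R v) (- t *\<^sub>R u + s *\<^sub>R v) = area_form g u v"
    "plane_metric g (s *\<^sub>R u + t *\<^sub>R v) (- t *\<^sub>R u + s *\<^sub>R v) = plane_metric g u v"
proof -
  note gs = bilinear_radd[OF assms(1)] bilinear_rmul[OF assms(1)] bilinear_rneg[OF assms(1)]
  show "area_form g (s *\<^sub>R u + t *\<^sub>R v) (- t *\<^sub>R u + s *\<^sub>R v) = area_form g u v"
    unfolding area_form_def gs real_scaleR_def by (intro ext) (use st in algebra)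
  show "plane_metric g (s *\<^sub>R u + t *\<^sub>R v) (- t *\<^sub>R u + s *\<^sub>R v) = plane_metric g u v"
    unfolding plane_metric_def gs real_scaleR_def by (intro ext) (use st in algebra)
qed

lemma rotation_killing_linear:
  obtains s t :: real where "s\<^sup>2 + t\<^sup>2 = 1" "s * \<alpha> + t * \<beta> = 0"
proof (cases "\<alpha> = 0 \<and> \<beta> = 0")
  case True
  then show thesis by (intro that[of 1 0]) auto
next
  case False
  define \<rho> where "\<rho> = sqrt (\<alpha>\<^sup>2 + \<beta>\<^sup>2)"
  have "\<rho>\<^sup>2 = \<beta>\<^sup>2 + \<alpha>\<^sup>2" and pos: "\<rho> > 0" using False by (auto simp: \<rho>_def sum_power2_gt_zero_iff)
  then have "(\<beta> / \<rho>)\<^sup>2 + (- \<alpha> / \<rho>)\<^sup>2 = 1"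
    by (simp add: power_divide flip: add_divide_distrib) (use pos in auto)
  then show thesis by (rule that) simp
qed

text \<open>Two parallel vectors \<open>p, q\<close> span at most a line, so some rotated combination \<open>s q - t p\<close> of
them vanishes.\<close>

lemma rotation_aligning_parallel:
  fixes p1 p2 p3 q1 q2 q3 :: real
  assumes "p1 * q2 = p2 * q1" "p1 * q3 = p3 * q1" "p2 * q3 = p3 * q2"
  obtains s t :: real where "s\<^sup>2 + t\<^sup>2 = 1" "s * q1 = t * p1" "s * q2 = t * p2" "s * q3 = t * p3"
proof (cases "p1 = 0 \<and> p2 = 0 \<and> p3 = 0")
  case True
  then show thesis by (intro that[of 0 1]) auto
next
  case False
  have "\<exists>k. q1 = k * p1 \<and> q2 = k * p2 \<and> q3 = k * p3"
  proof -
    consider "p1 \<noteq> 0" | "p2 \<noteq> 0" | "p3 \<noteq> 0" using False by blast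
    then show ?thesis
    proof cases
      case 1 then show ?thesis using assms by (intro exI[of _ "q1 / p1"]) (simp add: field_simps)
    next
      case 2 then show ?thesis using assms by (intro exI[of _ "q2 / p2"]) (simp add: field_simps)
    next
      case 3 then show ?thesis using assms by (intro exI[of _ "q3 / p3"]) (simp add: field_simps)
    qed
  qed
  then obtain k where k: "q1 = k * p1" "q2 = k * p2" "q3 = k * p3" by blast
  obtain s t :: real where "s\<^sup>2 + t\<^sup>2 = 1" "s * k + t * (- 1) = 0" by (rule rotation_killing_linear)
  moreover then have "t = s * k" by simp
  ultimately show thesis by (intro that[of s t]) (simp_all add: k)
qed

lemma adapted_frame_rotate_12:
  assumes ad: "adapted_frame b br g e l m" and g: "bilinear g" and st: "s\<^sup>2 + t\<^sup>2 = 1"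
  shows "adapted_frame b br g (frame_of (s *\<^sub>R e 1 + t *\<^sub>R e 2) (- t *\<^sub>R e 1 + s *\<^sub>R e 2) (e 3) (e 4)) l m"
proof -
  have "g (e i) (e j) = (if i = j then 1 else 0)" for i j
    using ad by (simp add: adapted_frame_def orthonormal_frame_def)
  note gs = this bilinear_radd[OF g] bilinear_rmul[OF g] bilinear_rneg[OF g]
    bilinear_ladd[OF g] bilinear_lmul[OF g] bilinear_lneg[OF g]
    bilinear_lsub[OF g] bilinear_rsub[OF g]
  show ?thesis
    using ad rotated_plane[OF g st, of "e 1" "e 2"] st unfolding adapted_frame_def
    by (simp add: orthonormal_frame_def forall_4 gs power2_eq_square algebra_simps)
qed

lemma adapted_frame_swap:
  assumes "adapted_frame b br g e l m"
  shows "adapted_frame b br g (frame_of (e 3) (e 4) (e 1) (e 2)) m l"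
  using assms by (simp add: adapted_frame_def orthonormal_frame_def forall_4 add.commute)

lemma adapted_frame_rotate_34:
  assumes ad: "adapted_frame b br g e l m" and g: "bilinear g" and st: "s\<^sup>2 + t\<^sup>2 = 1"
  shows "adapted_frame b br g (frame_of (e 1) (e 2) (s *\<^sub>R e 3 + t *\<^sub>R e 4) (- t *\<^sub>R e 3 + s *\<^sub>R e 4)) l m"
  using adapted_frame_swap[OF adapted_frame_rotate_12[OF adapted_frame_swap[OF ad] g st]] by simp

context metric_lie_algebra begin

text \<open>Evaluating \<open>de\<^sup>1\<^sup>2 = de\<^sup>3\<^sup>4 = 0\<close> on frame vectors: two vectors of the annihilated plane give
that it is a subalgebra, one gives that its action on the other plane is trace-free.\<close>

lemma adapted_bracket_relations:
  assumes "adapted_frame b br g e l m"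
  shows "C 1 2 3 = 0" "C 1 2 4 = 0" "C 3 4 1 = 0" "C 3 4 2 = 0"
    "C 3 2 2 = - C 3 1 1" "C 4 2 2 = - C 4 1 1" "C 4 1 4 = - C 3 1 3" "C 4 2 4 = - C 3 2 3"
proof -
  have 1: "ext_deriv br (area_form g (e 1) (e 2)) x y z = 0"
    and 2: "ext_deriv br (area_form g (e 3) (e 4)) x y z = 0" for x y z
    using assms by (auto simp: adapted_frame_def closed_form_def)
  note d = ext_deriv_def area_form_def g_frame C_def[symmetric]
  show "C 3 4 1 = 0" using 1[of "e 2" "e 3" "e 4"] by (simp add: d)
  show "C 3 4 2 = 0" using 1[of "e 1" "e 3" "e 4"] by (simp add: d)
  show "C 1 2 3 = 0" using 2[of "e 1" "e 2" "e 4"] by (simp add: d)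
  show "C 1 2 4 = 0" using 2[of "e 1" "e 2" "e 3"] by (simp add: d)
  show "C 3 2 2 = - C 3 1 1" using 1[of "e 3" "e 1" "e 2"] by (simp add: d)
  show "C 4 2 2 = - C 4 1 1" using 1[of "e 4" "e 1" "e 2"] by (simp add: d)
  show "C 4 1 4 = - C 3 1 3" using 2[of "e 1" "e 3" "e 4"] C_swap[of 1 3] C_swap[of 1 4] by (simp add: d)
  show "C 4 2 4 = - C 3 2 3" using 2[of "e 2" "e 3" "e 4"] C_swap[of 2 3] C_swap[of 2 4] by (simp add: d)
qed

lemma split_frame_if_adapted:
  assumes "adapted_frame b br g e l m" "C 1 2 1 = 0" "C 3 4 3 = 0"
  shows "split_frame b g e br (C 1 2 2) (C 3 4 4) (C 3 1 1) (C 3 1 2) (C 3 2 1) (C 4 1 1) (C 4 1 2) (C 4 2 1)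
    (- C 3 1 3) (- C 3 1 4) (- C 4 1 3) (- C 3 2 3) (- C 3 2 4) (- C 4 2 3)"
  by unfold_locales (subst br_frame, simp add: sum_4 adapted_bracket_relations[OF assms(1)] assms(2,3))+

text \<open>The bracket of an oriented orthonormal basis of \<open>P\<close> does not change under rotation, so
the first vector can be turned orthogonal to it.\<close>

lemma normalise_bracket_12:
  assumes ad: "adapted_frame b br g e l m"
  obtains e' where "adapted_frame b br g e' l m" "e' 3 = e 3" "e' 4 = e 4"
    "g (br (e' 1) (e' 2)) (e' 1) = 0"
proof -
  obtain s t :: real where st: "s\<^sup>2 + t\<^sup>2 = 1" and z: "s * C 1 2 1 + t * C 1 2 2 = 0"
    by (rule rotation_killing_linear)
  have "br (s *\<^sub>R e 1 + t *\<^sub>R e 2) (- t *\<^sub>R e 1 + s *\<^sub>R e 2) = (s\<^sup>2 + t\<^sup>2) *\<^sub>R br (e 1) (e 2)"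
    by (simp add: br_simps br_swap[of "e 2" "e 1"] power2_eq_square algebra_simps)
  then show thesis
    using z st adapted_frame_rotate_12[OF ad bilinear_g st]
    by (intro that[of "frame_of (s *\<^sub>R e 1 + t *\<^sub>R e 2) (- t *\<^sub>R e 1 + s *\<^sub>R e 2) (e 3) (e 4)"])
      (simp_all add: g_simps C_def)
qed

text \<open>If \<open>Q\<close> is abelian, \<open>[A\<^sub>3, A\<^sub>4] = 0\<close> makes the two trace-free matrices proportional, and \<open>Q\<close> can
be rotated until \<open>A\<^sub>4 = 0\<close>.\<close>

lemma align_34:
  assumes ad: "adapted_frame b br g e l m" and n: "C 1 2 1 = 0" "C 3 4 3 = 0" "C 3 4 4 = 0"
  obtains e' s t where "adapted_frame b br g e' l m" "e' 1 = e 1" "e' 2 = e 2"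
    "e' 3 = s *\<^sub>R e 3 + t *\<^sub>R e 4" "e' 4 = - t *\<^sub>R e 3 + s *\<^sub>R e 4" "br (e' 3) (e' 4) = 0"
    "g (br (e' 4) (e 1)) (e 1) = 0" "g (br (e' 4) (e 1)) (e 2) = 0" "g (br (e' 4) (e 2)) (e 1) = 0"
proof -
  interpret split_frame b g e br "C 1 2 2" "C 3 4 4" "C 3 1 1" "C 3 1 2" "C 3 2 1" "C 4 1 1" "C 4 1 2" "C 4 2 1"
    "- C 3 1 3" "- C 3 1 4" "- C 4 1 3" "- C 3 2 3" "- C 3 2 4" "- C 4 2 3"
    by (rule split_frame_if_adapted[OF ad n(1,2)])
  have "C 3 1 1 * C 4 1 2 = C 3 1 2 * C 4 1 1" "C 3 1 1 * C 4 2 1 = C 3 2 1 * C 4 1 1"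
    "C 3 1 2 * C 4 2 1 = C 3 2 1 * C 4 1 2"
    using jacobi_rep_A n(3) by (simp_all add: algebra_simps)
  from rotation_aligning_parallel[OF this] obtain s t :: real where st: "s\<^sup>2 + t\<^sup>2 = 1"
    and z: "s * C 4 1 1 = t * C 3 1 1" "s * C 4 1 2 = t * C 3 1 2" "s * C 4 2 1 = t * C 3 2 1"
    by metis
  have "br (s *\<^sub>R e 3 + t *\<^sub>R e 4) (- t *\<^sub>R e 3 + s *\<^sub>R e 4) = 0"
    using n br34 by (simp add: br_simps br_swap[of "e 4" "e 3"])
  then show thesis
    using z adapted_frame_rotate_34[OF ad bilinear_g st]
    by (intro that[of "frame_of (e 1) (e 2) (s *\<^sub>R e 3 + t *\<^sub>R e 4) (- t *\<^sub>R e 3 + s *\<^sub>R e 4)"])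
      (simp_all add: g_simps br_simps C_def)
qed

lemma adapted_ricci:
  assumes "adapted_frame b br g e l m"
  shows "ricci b br g (e 1) (e 1) = l" "ricci b br g (e 2) (e 2) = l" "ricci b br g (e 3) (e 3) = m"
    "ricci b br g (e 4) (e 4) = m" "ricci b br g (e 1) (e 3) = 0"
  using assms by (simp_all add: adapted_frame_def plane_metric_def g_frame)

end

definition isomorphic_to_model :: "('a::real_vector \<Rightarrow> 'a \<Rightarrow> 'a) \<Rightarrow> bool" where
  "isomorphic_to_model br \<longleftrightarrow> lie_isomorphic br two_A2 \<or> lie_isomorphic br A2_plus_2A1 \<or>
    (\<exists>a. a \<noteq> 0 \<and> lie_isomorphic br (A4_6_0 a)) \<or> lie_isomorphic br A4_9_minus_half"

lemma metric_lie_algebra_if_adapted: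
  "lie_bracket br \<Longrightarrow> is_basis b \<Longrightarrow> inner_product g \<Longrightarrow> adapted_frame b br g e l m \<Longrightarrow>
    metric_lie_algebra b g e br"
  by unfold_locales (auto simp: adapted_frame_def)

lemma isomorphic_to_model_if_12_nonabelian:
  assumes lie: "lie_bracket br" and b: "is_basis b" and g: "inner_product g"
    and ad: "adapted_frame b br g e l m" and lm: "l \<noteq> m"
    and n: "g (br (e 1) (e 2)) (e 1) = 0" "g (br (e 3) (e 4)) (e 3) = 0" and a: "g (br (e 1) (e 2)) (e 2) \<noteq> 0"
  shows "isomorphic_to_model br"
proof -
  interpret metric_lie_algebra b g e br by (rule metric_lie_algebra_if_adapted[OF lie b g ad])
  have n': "C 1 2 1 = 0" "C 3 4 3 = 0" "C 1 2 2 \<noteq> 0" using n a by (simp_all add: C_def)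
  show ?thesis
  proof (cases "C 3 4 4 = 0")
    case False
    interpret split_frame b g e br "C 1 2 2" "C 3 4 4" "C 3 1 1" "C 3 1 2" "C 3 2 1" "C 4 1 1" "C 4 1 2" "C 4 2 1"
      "- C 3 1 3" "- C 3 1 4" "- C 4 1 3" "- C 3 2 3" "- C 3 2 4" "- C 4 2 3"
      by (rule split_frame_if_adapted[OF ad n'(1,2)])
    show ?thesis
      using classify_both_nonabelian n' False adapted_ricci[OF ad] lm by (auto simp: isomorphic_to_model_def)
  next
    case True
    obtain e' s t where ad': "adapted_frame b br g e' l m" and e': "e' 1 = e 1" "e' 2 = e 2" "br (e' 3) (e' 4) = 0"
      "g (br (e' 4) (e 1)) (e 1) = 0" "g (br (e' 4) (e 1)) (e 2) = 0" "g (br (e' 4) (e 2)) (e 1) = 0"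
      by (rule align_34[OF ad n'(1,2) True]) (rule that; assumption)
    interpret n: metric_lie_algebra b g e' br by (rule metric_lie_algebra_if_adapted[OF lie b g ad'])
    have c: "n.C 1 2 1 = 0" "n.C 3 4 3 = 0" "n.C 1 2 2 \<noteq> 0" "n.C 3 4 4 = 0"
      "n.C 4 1 1 = 0" "n.C 4 1 2 = 0" "n.C 4 2 1 = 0"
      using n a by (simp_all add: n.C_def e' g_simps)
    interpret n: split_frame b g e' br "n.C 1 2 2" "n.C 3 4 4" "n.C 3 1 1" "n.C 3 1 2" "n.C 3 2 1" "n.C 4 1 1" "n.C 4 1 2" "n.C 4 2 1"
      "- n.C 3 1 3" "- n.C 3 1 4" "- n.C 4 1 3" "- n.C 3 2 3" "- n.C 3 2 4" "- n.C 4 2 3"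
      by (rule n.split_frame_if_adapted[OF ad' c(1,2)])
    show ?thesis
      using n.classify_one_nonabelian c n.adapted_ricci[OF ad'] by (auto simp: isomorphic_to_model_def)
  qed
qed

text \<open>First \<open>Q\<close> is rotated to reach \<open>A\<^sub>4 = 0\<close>, then, with the roles exchanged, \<open>P\<close> to reach \<open>B\<^sub>2 = 0\<close>.
The vanishing of \<open>A\<^sub>4\<close> as a map survives the second rotation.\<close>

lemma not_both_abelian:
  assumes lie: "lie_bracket br" and b: "is_basis b" and g: "inner_product g"
    and ad: "adapted_frame b br g e l m" and z: "br (e 1) (e 2) = 0" "br (e 3) (e 4) = 0"
  shows "l = m"
proof -
  interpret metric_lie_algebra b g e br by (rule metric_lie_algebra_if_adapted[OF lie b g ad])
  have n: "C 1 2 1 = 0" "C 3 4 3 = 0" "C 3 4 4 = 0" using z by (simp_all add: C_def g_simps)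
  obtain e' s t where ad': "adapted_frame b br g e' l m" and e': "e' 1 = e 1" "e' 2 = e 2" "br (e' 3) (e' 4) = 0"
    "g (br (e' 4) (e 1)) (e 1) = 0" "g (br (e' 4) (e 1)) (e 2) = 0" "g (br (e' 4) (e 2)) (e 1) = 0"
    by (rule align_34[OF ad n]) (rule that; assumption)
  let ?f = "frame_of (e' 3) (e' 4) (e' 1) (e' 2)"
  note adf = adapted_frame_swap[OF ad']
  interpret n: metric_lie_algebra b g e' br by (rule metric_lie_algebra_if_adapted[OF lie b g ad'])
  interpret f: metric_lie_algebra b g ?f br by (rule metric_lie_algebra_if_adapted[OF lie b g adf])
  have nf: "f.C 1 2 1 = 0" "f.C 3 4 3 = 0" "f.C 3 4 4 = 0"
    unfolding f.C_def using z e' by (simp_all add: g_simps)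
  obtain h s t where adh: "adapted_frame b br g h m l" and h: "h 1 = e' 3" "h 2 = e' 4" "br (h 3) (h 4) = 0"
    "h 3 = s *\<^sub>R e 1 + t *\<^sub>R e 2" "h 4 = - t *\<^sub>R e 1 + s *\<^sub>R e 2"
    "g (br (h 4) (e' 3)) (e' 3) = 0" "g (br (h 4) (e' 3)) (e' 4) = 0" "g (br (h 4) (e' 4)) (e' 3) = 0"
    by (rule f.align_34[OF adf nf, unfolded frame_of_simps e'(1,2)]) (rule that; assumption)
  let ?k = "frame_of (h 3) (h 4) (h 1) (h 2)"
  note adk = adapted_frame_swap[OF adh]
  interpret k: metric_lie_algebra b g ?k br by (rule metric_lie_algebra_if_adapted[OF lie b g adk])
  \<comment> \<open>The last entry of \<open>A\<^sub>4\<close> vanishes because \<open>A\<^sub>4\<close> is trace-free.\<close>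
  have nil: "g (br (e' 4) (e 2)) (e 2) = 0"
    using n.adapted_bracket_relations(6)[OF ad'] e' by (simp add: n.C_def)
  have c1: "k.C 1 2 1 = 0" "k.C 1 2 2 = 0" "k.C 3 4 3 = 0" "k.C 3 4 4 = 0"
    unfolding k.C_def using h e' z by (simp_all add: g_simps)
  have c2: "k.C 4 1 1 = 0" "k.C 4 1 2 = 0" "k.C 4 2 1 = 0"
    unfolding k.C_def by (simp_all add: h(1,2,4,5) br_simps g_simps e' nil)
  have c3: "k.C 3 2 3 = 0" "k.C 3 2 4 = 0" "k.C 4 2 3 = 0"
    unfolding k.C_def using h(6-8)
    by (simp_all add: h(1,2) g_simps br_swap[of "e' 3" "h 4"] br_swap[of "e' 4" "h 4"])
  interpret k: split_frame b g ?k br "k.C 1 2 2" "k.C 3 4 4" "k.C 3 1 1" "k.C 3 1 2" "k.C 3 2 1" "k.C 4 1 1" "k.C 4 1 2" "k.C 4 2 1"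
    "- k.C 3 1 3" "- k.C 3 1 4" "- k.C 4 1 3" "- k.C 3 2 3" "- k.C 3 2 4" "- k.C 4 2 3"
    by (rule k.split_frame_if_adapted[OF adk c1(1,3)])
  show ?thesis
    using k.ricci_eq_if_abelian c1 c2 c3 k.adapted_ricci[OF adk] by simp
qed

lemma isomorphic_to_model_if_adapted:
  assumes lie: "lie_bracket br" and b: "is_basis b" and g: "inner_product g"
    and ad: "adapted_frame b br g e l m" and lm: "l \<noteq> m"
  shows "isomorphic_to_model br"
proof -
  interpret metric_lie_algebra b g e br by (rule metric_lie_algebra_if_adapted[OF lie b g ad])
  obtain e1 where ad1: "adapted_frame b br g e1 l m" and e1: "g (br (e1 1) (e1 2)) (e1 1) = 0"
    by (rule normalise_bracket_12[OF ad]) (rule that; assumption)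
  note adf = adapted_frame_swap[OF ad1]
  let ?f = "frame_of (e1 3) (e1 4) (e1 1) (e1 2)"
  interpret f: metric_lie_algebra b g ?f br by (rule metric_lie_algebra_if_adapted[OF lie b g adf])
  obtain h where adh: "adapted_frame b br g h m l" and h: "h 3 = e1 1" "h 4 = e1 2" "g (br (h 1) (h 2)) (h 1) = 0"
    by (rule f.normalise_bracket_12[OF adf, unfolded frame_of_simps]) (rule that; assumption)
  then have nh: "g (br (h 1) (h 2)) (h 1) = 0" "g (br (h 3) (h 4)) (h 3) = 0" using e1 by simp_all
  interpret h: metric_lie_algebra b g h br by (rule metric_lie_algebra_if_adapted[OF lie b g adh])
  show ?thesis
  proof (cases "g (br (h 1) (h 2)) (h 2) = 0")
    case False
    then show ?thesis using isomorphic_to_model_if_12_nonabelian[OF lie b g adh] lm nh by simp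
  next
    case 1: True
    show ?thesis
    proof (cases "g (br (h 3) (h 4)) (h 4) = 0")
      case False
      then show ?thesis using isomorphic_to_model_if_12_nonabelian[OF lie b g adapted_frame_swap[OF adh]] lm nh by simp
    next
      case True
      have "br (h 1) (h 2) = 0" "br (h 3) (h 4) = 0"
        using h.adapted_bracket_relations(1-4)[OF adh] nh 1 True
        by (auto intro!: h.frame_eqI4 simp: h.C_def g_simps)
      then show ?thesis using not_both_abelian[OF lie b g adh] lm by simp
    qed
  qed
qed

section \<open>Solutions on the model algebras\<close>

context split_frame begin

lemma g_br: "g (br x y) (e k) = (\<Sum>i\<in>UNIV. \<Sum>j\<in>UNIV. g x (e i) * g y (e j) * C i j k)"
proof -
  have "br x y = (\<Sum>i\<in>UNIV. \<Sum>j\<in>UNIV. (g x (e i) * g y (e j)) *\<^sub>R br (e i) (e j))"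
    by (subst frame_expand[of x], subst frame_expand[of y]) (rule bilinear_sum_sum[OF bilinear_br])
  then show ?thesis by (simp add: linear_sum[OF linear_g(1)] g_simps C_def)
qed

lemma closed_area_forms:
  "closed_form br (area_form g (e 1) (e 2))" "closed_form br (area_form g (e 3) (e 4))"
  unfolding closed_form_def ext_deriv_def area_form_def g_br
  by (simp_all add: sum_4 C_table C_diag algebra_simps)

lemma adapted_if_ricci:
  assumes "\<forall>i j. ricci b br g (e i) (e j) = block_metric l m (e i) (e j)"
  shows "adapted_frame b br g e l m"
proof -
  have "ricci b br g x y = block_metric l m x y" for x y
    by (rule bilinear_on_basis[OF bilinear_ricci
        bilinear_lincomb[OF bilinear_plane_metric bilinear_plane_metric] basis_frame])
      (rule assms[rule_format])
  then show ?thesis using frame closed_area_forms unfolding adapted_frame_def by blast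
qed

text \<open>With \<open>A = 0\<close>, \<open>B\<^sub>2 = 0\<close> and \<open>B\<^sub>1\<close> skew, the curvature is that of the product of two surfaces of
curvature \<open>-a\<^sup>2\<close> and \<open>-c\<^sup>2\<close>.\<close>

lemma adapted_if_rotation:
  assumes "q1 = 0" "q2 = 0" "q3 = 0" "y1 = 0" "y2 = 0" "p1 = 0" "p2 = 0" "p3 = 0"
    "x1 = 0" "x3 = - x2" "y3 = 0"
  shows "adapted_frame b br g e (- a\<^sup>2) (- c\<^sup>2)"
proof -
  have "x2 = 0 \<or> c = 0" using jacobi_match_B(1) by (auto simp: assms)
  then show ?thesis
    by (intro adapted_if_ricci, unfold forall_4)
      (simp add: ricci_frame sum_4 \<Gamma>_def C_table C_diag assms plane_metric_def g_frame power2_eq_square)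
qed

text \<open>The weights of \<open>e\<^sub>1\<close> on \<open>e\<^sub>2, e\<^sub>3, e\<^sub>4\<close> are \<open>1, 1/2, -1/2\<close>. The bracket \<open>[e\<^sub>2, e\<^sub>4] = e\<^sub>3\<close> is scaled
so that its contribution to the Ricci tensor cancels that of \<open>e\<^sub>1\<close> on \<open>e\<^sub>3\<close> and \<open>e\<^sub>4\<close> and equalises
\<open>Ric(e\<^sub>1, e\<^sub>1)\<close> and \<open>Ric(e\<^sub>2, e\<^sub>2)\<close>.\<close>

lemma adapted_A4_9_minus_half:
  assumes "q1 = 0" "q2 = 0" "q3 = 0" "y1 = 0" "y2 = 0" "p1 = 0" "p2 = 0" "p3 = 0"
    "a = 1" "c = 0" "x1 = 1/2" "x2 = 0" "x3 = 0" "y3 = 1"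
  shows "adapted_frame b br g e (- 3/2) 0"
  by (rule adapted_if_ricci, unfold forall_4)
    (simp add: ricci_frame sum_4 \<Gamma>_def C_table C_diag assms plane_metric_def g_frame power2_eq_square)

end

lemma basis_from_isomorphism:
  fixes b :: "4 \<Rightarrow> 'a::real_vector"
  assumes iso: "lie_isomorphic br (bracket_from T)" and b: "is_basis b"
  obtains f :: "4 \<Rightarrow> 'a" where "is_basis f"
    "\<And>i j. br (f i) (f j) = (\<Sum>k\<in>UNIV. bracket_from T (std i) (std j) $ k *\<^sub>R f k)"
proof -
  obtain \<phi> where lin: "linear \<phi>" and bij: "bij \<phi>"
    and hom: "\<And>x y. \<phi> (br x y) = bracket_from T (\<phi> x) (\<phi> y)"
    using iso by (auto simp: lie_isomorphic_def)
  have inj: "\<phi> x = \<phi> y \<Longrightarrow> x = y" for x y using bij by (simp add: bij_def inj_eq)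
  define f where "f i = inv \<phi> (std i)" for i
  have \<phi>f: "\<phi> (f i) = std i" for i using bij by (simp add: f_def bij_is_surj surj_f_inv_f)
  have std_sum: "(\<Sum>k\<in>UNIV. v $ k *\<^sub>R std k) = v" for v
    by (simp add: vec_eq_iff axis_def if_distrib cong: if_cong)
  have expand: "x = (\<Sum>k\<in>UNIV. \<phi> x $ k *\<^sub>R f k)" for x
    by (rule inj) (simp add: linear_sum[OF lin] linear_cmul[OF lin] \<phi>f std_sum)
  have "x \<in> span (range f)" for x
    by (subst expand) (intro span_sum span_scale span_base, simp)
  then have "is_basis f" by (intro is_basis_if_spans[OF b]) blast
  moreover have "br (f i) (f j) = (\<Sum>k\<in>UNIV. bracket_from T (std i) (std j) $ k *\<^sub>R f k)" for i j
    using expand[of "br (f i) (f j)"] by (simp add: hom \<phi>f)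
  ultimately show thesis by (rule that)
qed

lemma metric_making_orthonormal:
  assumes e: "is_basis e"
  obtains g where "inner_product g" "orthonormal_frame g e"
proof
  let ?g = "\<lambda>x y. coord e x \<bullet> coord e y"
  note lin = linear_coord[OF e]
  have "coord e x \<noteq> 0" if "x \<noteq> 0" for x
    using that bij_coord[OF e] linear_0[OF lin] by (metis bij_pointE)
  then show "inner_product ?g"
    by (auto simp: inner_product_def inner_commute
        intro!: bilinearI simp: linear_add[OF lin] linear_cmul[OF lin] inner_add_left inner_add_right)
  show "orthonormal_frame ?g e"
    by (simp add: orthonormal_frame_def coord_basis[OF e] inner_axis_axis)
qed

text \<open>The bracket tables of all four models, written in a frame whose first two vectors span
\<open>P\<close>.\<close>

lemma einstein_maxwell_if_table:
  fixes b :: "4 \<Rightarrow> 'a::real_vector"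
  assumes lie: "lie_bracket br" and b: "is_basis b" and e: "is_basis e"
    and table: "br (e 1) (e 2) = a *\<^sub>R e 2" "br (e 3) (e 4) = c *\<^sub>R e 4"
      "br (e 3) (e 1) = - x1 *\<^sub>R e 3 - x2 *\<^sub>R e 4" "br (e 3) (e 2) = 0"
      "br (e 4) (e 1) = - x3 *\<^sub>R e 3 + x1 *\<^sub>R e 4" "br (e 4) (e 2) = - y3 *\<^sub>R e 3"
    and "x1 = 0 \<and> x3 = - x2 \<and> y3 = 0 \<and> a\<^sup>2 \<noteq> c\<^sup>2 \<or> a = 1 \<and> c = 0 \<and> x1 = 1/2 \<and> x2 = 0 \<and> x3 = 0 \<and> y3 = 1"
  shows "\<exists>g F. einstein_maxwell b br g F \<and> \<not> einstein b br g"
proof -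
  obtain g where g: "inner_product g" "orthonormal_frame g e"
    by (rule metric_making_orthonormal[OF e]) (rule that; assumption)
  interpret split_frame b g e br a c 0 0 0 0 0 0 x1 x2 x3 0 0 y3
    by unfold_locales (use lie b g table in simp_all)
  have "\<exists>l m. l \<noteq> m \<and> adapted_frame b br g e l m"
    using assms(10) adapted_if_rotation adapted_A4_9_minus_half
    by (metis (no_types, opaque_lifting) divide_eq_0_iff neg_equal_iff_equal neg_equal_0_iff_equal zero_neq_numeral)
  then show ?thesis using einstein_maxwell_if_adapted by blast
qed

lemma is_basis_permuted:
  assumes f: "is_basis f" and "\<And>i. f i \<in> span {u1, u2, u3, u4}"
  shows "is_basis (frame_of u1 u2 u3 u4)"
  by (rule is_basis_if_spans[OF f]) (use assms(2) in \<open>auto simp: UNIV_4\<close>)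

lemma einstein_maxwell_if_isomorphic_to_model:
  fixes b :: "4 \<Rightarrow> 'a::real_vector"
  assumes lie: "lie_bracket br" and b: "is_basis b" and l: "isomorphic_to_model br"
  shows "\<exists>g F. einstein_maxwell b br g F \<and> \<not> einstein b br g"
proof -
  note model = bracket_from_Cons bracket_from_Nil axis_def sum_4
  have neg: "br (- x) y = - br x y" "br x (- y) = - br x y" "br x (c *\<^sub>R y) = c *\<^sub>R br x y" "br (c *\<^sub>R x) y = c *\<^sub>R br x y" for x y c
    using lie by (simp_all add: lie_bracket_def bilinear_lneg bilinear_rneg bilinear_lmul bilinear_rmul)
  consider "lie_isomorphic br two_A2" | "lie_isomorphic br A2_plus_2A1"
    | \<alpha> where "\<alpha> \<noteq> 0" "lie_isomorphic br (A4_6_0 \<alpha>)" | "lie_isomorphic br A4_9_minus_half"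
    using l by (auto simp: isomorphic_to_model_def)
  then show ?thesis
  proof cases
    case 1
    obtain f :: "4 \<Rightarrow> 'a" where f: "is_basis f"
      and br: "\<And>i j. br (f i) (f j) = (\<Sum>k\<in>UNIV. bracket_from [(1, 2, std 2), (3, 4, std 4)] (std i) (std j) $ k *\<^sub>R f k)"
      by (rule basis_from_isomorphism[OF 1[unfolded two_A2_def] b]) (rule that; assumption)
    \<comment> \<open>The third basis vector is doubled so that the two factors have the different
    curvatures \<open>-1\<close> and \<open>-4\<close>; with equal curvatures the product would be Einstein.\<close>
    have "f i \<in> span {f 1, f 2, 2 *\<^sub>R f 3, f 4}" for i
    proof -
      have "f 3 = (1/2) *\<^sub>R (2 *\<^sub>R f 3)" by simp
      then have "f 3 \<in> span {f 1, f 2, 2 *\<^sub>R f 3, f 4}" by (metis insertCI span_base span_scale)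
      then have "\<forall>i. f i \<in> span {f 1, f 2, 2 *\<^sub>R f 3, f 4}" unfolding forall_4 by (auto intro: span_base)
      then show ?thesis by blast
    qed
    from is_basis_permuted[OF f this] show ?thesis
      by (rule einstein_maxwell_if_table[OF lie b, where a = 1 and c = 2 and ?x1.0 = 0 and ?x2.0 = 0 and ?x3.0 = 0 and ?y3.0 = 0])
        (simp_all add: neg br model)
  next
    case 2
    obtain f :: "4 \<Rightarrow> 'a" where f: "is_basis f"
      and br: "\<And>i j. br (f i) (f j) = (\<Sum>k\<in>UNIV. bracket_from [(1, 2, std 2)] (std i) (std j) $ k *\<^sub>R f k)"
      by (rule basis_from_isomorphism[OF 2[unfolded A2_plus_2A1_def] b]) (rule that; assumption)
    show ?thesis
      by (rule einstein_maxwell_if_table[OF lie b f, where a = 1 and c = 0 and ?x1.0 = 0 and ?x2.0 = 0 and ?x3.0 = 0 and ?y3.0 = 0])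
        (simp_all add: br model)
  next
    case 3
    obtain f :: "4 \<Rightarrow> 'a" where f: "is_basis f"
      and br: "\<And>i j. br (f i) (f j) = (\<Sum>k\<in>UNIV. bracket_from [(1, 4, \<alpha> *\<^sub>R std 1), (2, 4, - std 3), (3, 4, std 2)] (std i) (std j) $ k *\<^sub>R f k)"
      by (rule basis_from_isomorphism[OF 3(2)[unfolded A4_6_0_def] b]) (rule that; assumption)
    have "\<forall>i. f i \<in> span {f 4, f 1, f 2, f 3}" unfolding forall_4 by (auto intro: span_base)
    then have "is_basis (frame_of (f 4) (f 1) (f 2) (f 3))" by (intro is_basis_permuted[OF f]) blast
    then show ?thesis
      by (rule einstein_maxwell_if_table[OF lie b, where a = "- \<alpha>" and c = 0 and ?x1.0 = 0 and ?x2.0 = 1 and ?x3.0 = "- 1" and ?y3.0 = 0])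
        (simp_all add: br model 3(1))
  next
    case 4
    obtain f :: "4 \<Rightarrow> 'a" where f: "is_basis f"
      and br: "\<And>i j. br (f i) (f j) = (\<Sum>k\<in>UNIV. bracket_from [(2, 3, std 1), (1, 4, (1/2) *\<^sub>R std 1), (2, 4, std 2), (3, 4, (- 1/2) *\<^sub>R std 3)] (std i) (std j) $ k *\<^sub>R f k)"
      by (rule basis_from_isomorphism[OF 4[unfolded A4_9_minus_half_def] b]) (rule that; assumption)
    have "f i \<in> span {- f 4, f 2, f 1, f 3}" for i
    proof -
      have "f 4 = - (- f 4)" by simp
      then have "f 4 \<in> span {- f 4, f 2, f 1, f 3}" by (metis insertCI span_base span_neg)
      then have "\<forall>i. f i \<in> span {- f 4, f 2, f 1, f 3}" unfolding forall_4 by (auto intro: span_base)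
      then show ?thesis by blast
    qed
    from is_basis_permuted[OF f this] show ?thesis
      by (rule einstein_maxwell_if_table[OF lie b, where a = 1 and c = 0 and ?x1.0 = "1/2" and ?x2.0 = 0 and ?x3.0 = 0 and ?y3.0 = 1])
        (simp_all add: neg br model)
  qed
qed

theorem theorem1p1:
  fixes br :: "'a::real_vector \<Rightarrow> 'a \<Rightarrow> 'a"
    and b :: "4 \<Rightarrow> 'a"
  assumes "lie_bracket br"
    and "is_basis b"
  shows "(\<exists>g F. einstein_maxwell b br g F \<and> \<not> einstein b br g) \<longleftrightarrow>
    lie_isomorphic br two_A2 \<or>
    lie_isomorphic br A2_plus_2A1 \<or>
    (\<exists>a. a \<noteq> 0 \<and> lie_isomorphic br (A4_6_0 a)) \<or>
    lie_isomorphic br A4_9_minus_half"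
proof
  assume "\<exists>g F. einstein_maxwell b br g F \<and> \<not> einstein b br g"
  then obtain g F where em: "einstein_maxwell b br g F" and ne: "\<not> einstein b br g" by blast
  obtain e l m where "l \<noteq> m" "adapted_frame b br g e l m"
    by (rule adapted_frame_if_einstein_maxwell[OF assms em ne]) (rule that; assumption)
  moreover have "inner_product g" using em by (simp add: einstein_maxwell_def)
  ultimately have "isomorphic_to_model br" by (intro isomorphic_to_model_if_adapted[OF assms])
  then show "lie_isomorphic br two_A2 \<or> lie_isomorphic br A2_plus_2A1 \<or>
    (\<exists>a. a \<noteq> 0 \<and> lie_isomorphic br (A4_6_0 a)) \<or> lie_isomorphic br A4_9_minus_half"
    unfolding isomorphic_to_model_def .
qed (rule einstein_maxwell_if_isomorphic_to_model[OF assms], simp add: isomorphic_to_model_def)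

end
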